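(* Let $n>m\ge2$ be integers with $\frac{\log n}{\log m}\in\mathbb{Q}$, let $K=K(n,m,\Lambda)\subset\mathbb{R}^2$ be a Bedford-McMullen carpet, and let $f:\mathbb{R}^2\to\mathbb{R}^2$ be a similitude with similarity ratio $\lambda>0$ such that $f(K)\subset K$. If $K$ is not contained in any line, then $\frac{\log\lambda}{\log n}\in\mathbb{Q}$.
   Context: Bedford-McMullen carpet: let $n>m\ge 2$ be integers and $\Lambda\subset\{0,\dots,n-1\}\times\{0,\dots,m-1\}$ with $1<\#\Lambda<mn$ (this cardinality condition is always assumed). Put $\varphi_{i,j}(x,y)=\left(\frac{x+i}{n},\frac{y+j}{m}\right)$ for $(i,j)\in\Lambda$. Then $K(n,m,\Lambda)$ is the attractor of $\{\varphi_{i,j}\}_{(i,j)\in\Lambda}$, i.e. $K(n,m,\Lambda)=\left\{\left(\sum_{k\ge1} i_k n^{-k},\sum_{k\ge1} j_k m^{-k}\right):(i_k,j_k)\in\Lambda\text{ for all }k\right\}$. Similitude: a map $f(x)=\lambda Ox+a$ on $\mathbb{R}^2$ where $\lambda$ is the similarity ratio, $O$ is an orthogonal transformation of $\mathbb{R}^2$ and $a\in\mathbb{R}^2$. *)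

theory Defs
  imports "HOL-Analysis.Analysis"
begin

text \<open>The plane is \<open>real \<times> real\<close>, which carries the Euclidean inner product and norm.\<close>

definition bm_digits :: "nat \<Rightarrow> nat \<Rightarrow> (nat \<times> nat) set \<Rightarrow> bool" where
  "bm_digits n m \<Lambda> \<longleftrightarrow>
     2 \<le> m \<and> m < n \<and> \<Lambda> \<subseteq> {0..<n} \<times> {0..<m} \<and> 1 < card \<Lambda> \<and> card \<Lambda> < m * n"

definition bm_map :: "nat \<Rightarrow> nat \<Rightarrow> nat \<times> nat \<Rightarrow> real \<times> real \<Rightarrow> real \<times> real" where
  "bm_map n m d p = ((fst p + real (fst d)) / real n, (snd p + real (snd d)) / real m)"

text \<open>The carpet is given by its digit expansions (indexed from \<open>0\<close>, hence the exponents
  \<open>Suc k\<close>); by \<open>is_attractor_bm_carpet_iff\<close> below it is the unique attractor of the maps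
  \<open>bm_map n m d\<close> with \<open>d \<in> \<Lambda>\<close>.\<close>

definition bm_carpet :: "nat \<Rightarrow> nat \<Rightarrow> (nat \<times> nat) set \<Rightarrow> (real \<times> real) set" where
  "bm_carpet n m \<Lambda> =
     {(\<Sum>k. real (fst (s k)) / real n ^ Suc k, \<Sum>k. real (snd (s k)) / real m ^ Suc k) | s.
        \<forall>k. s k \<in> \<Lambda>}"

definition is_attractor :: "'i set \<Rightarrow> ('i \<Rightarrow> 'a::topological_space \<Rightarrow> 'a) \<Rightarrow> 'a set \<Rightarrow> bool" where
  "is_attractor I \<phi> K \<longleftrightarrow> compact K \<and> K \<noteq> {} \<and> K = (\<Union>i\<in>I. \<phi> i ` K)"

definition is_similitude :: "real \<Rightarrow> (real \<times> real \<Rightarrow> real \<times> real) \<Rightarrow> bool" where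
  "is_similitude r f \<longleftrightarrow>
     (\<exists>T a. orthogonal_transformation T \<and> (\<forall>x. f x = r *\<^sub>R T x + a))"

lemma digit_bound:
  fixes b :: nat
  assumes "2 \<le> b" "d < b"
  shows "norm (real d / real b ^ Suc k) \<le> (1 / real b) ^ k"
proof -
  have "real d / real b \<le> 1" using assms by simp
  then have "real d / real b * (1 / real b ^ k) \<le> 1 * (1 / real b ^ k)"
    by (rule mult_right_mono) simp
  then show ?thesis by (simp add: power_divide)
qed

lemma summable_geom_inv:
  fixes b :: nat
  assumes "2 \<le> b"
  shows "summable (\<lambda>k. (1 / real b) ^ k)"
  using assms by (intro summable_geometric) simp

lemma digit_summable:
  fixes b :: nat
  assumes "2 \<le> b" "\<And>k. d k < b"
  shows "summable (\<lambda>k. real (d k) / real b ^ Suc k)"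
  by (rule summable_comparison_test'[OF summable_geom_inv[OF assms(1)]])
     (rule digit_bound[OF assms])

lemma digit_shift:
  fixes b :: nat
  assumes "2 \<le> b" "\<And>k. d k < b"
  shows "(\<Sum>k. real (d k) / real b ^ Suc k)
       = ((\<Sum>k. real (d (Suc k)) / real b ^ Suc k) + real (d 0)) / real b"
proof -
  have "(\<Sum>k. real (d k) / real b ^ Suc k)
      = (\<Sum>k. real (d (Suc k)) / real b ^ Suc (Suc k)) + real (d 0) / real b"
  proof -
    define h where "h k = real (d k) / real b ^ Suc k" for k
    have "summable h" unfolding h_def by (rule digit_summable[OF assms])
    from suminf_split_head[OF this] have "suminf h = (\<Sum>k. h (Suc k)) + h 0" by linarith
    moreover have "suminf h = (\<Sum>k. real (d k) / real b ^ Suc k)"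
      unfolding h_def ..
    ultimately show ?thesis by (simp add: h_def)
  qed
  also have "(\<Sum>k. real (d (Suc k)) / real b ^ Suc (Suc k))
      = (\<Sum>k. real (d (Suc k)) / real b ^ Suc k / real b)"
    by (simp add: mult.commute mult.left_commute)
  also have "\<dots> = (\<Sum>k. real (d (Suc k)) / real b ^ Suc k) / real b"
    by (rule suminf_divide) (rule digit_summable[OF assms(1)], rule assms(2))
  finally show ?thesis by (simp add: add_divide_distrib)
qed

lemma bm_carpet_fixed:
  assumes "bm_digits n m \<Lambda>"
  shows "bm_carpet n m \<Lambda> = (\<Union>d\<in>\<Lambda>. bm_map n m d ` bm_carpet n m \<Lambda>)"
proof -
  define P where "P s = (\<Sum>k. real (fst (s k)) / real n ^ Suc k,
    \<Sum>k. real (snd (s k)) / real m ^ Suc k)" for s :: "nat \<Rightarrow> nat \<times> nat"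
  have K: "bm_carpet n m \<Lambda> = {P s | s. \<forall>k. s k \<in> \<Lambda>}"
    unfolding bm_carpet_def P_def ..
  have nm: "2 \<le> n" "2 \<le> m" and lt: "\<And>d. d \<in> \<Lambda> \<Longrightarrow> fst d < n \<and> snd d < m"
    using assms by (auto simp: bm_digits_def)
  have P: "P s = bm_map n m (s 0) (P (\<lambda>k. s (Suc k)))" if "\<forall>k. s k \<in> \<Lambda>" for s
    unfolding P_def bm_map_def using that lt
    by (subst (1 2) digit_shift) (use nm in auto)
  show ?thesis
  proof (intro equalityI subsetI)
    fix x assume "x \<in> bm_carpet n m \<Lambda>"
    then obtain s where s: "x = P s" "\<forall>k. s k \<in> \<Lambda>" unfolding K by blast
    then have "P (\<lambda>k. s (Suc k)) \<in> bm_carpet n m \<Lambda>" unfolding K by blast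
    then show "x \<in> (\<Union>d\<in>\<Lambda>. bm_map n m d ` bm_carpet n m \<Lambda>)"
      using s P[OF s(2)] by blast
  next
    fix x assume "x \<in> (\<Union>d\<in>\<Lambda>. bm_map n m d ` bm_carpet n m \<Lambda>)"
    then obtain d s where s: "d \<in> \<Lambda>" "x = bm_map n m d (P s)" "\<forall>k. s k \<in> \<Lambda>"
      unfolding K by blast
    define t where "t k = (case k of 0 \<Rightarrow> d | Suc j \<Rightarrow> s j)" for k
    have t: "\<forall>k. t k \<in> \<Lambda>" using s by (auto simp: t_def split: nat.split)
    have "t 0 = d" "(\<lambda>k. t (Suc k)) = s" by (simp_all add: t_def)
    then have "x = P t" using P[OF t] s by simp
    then show "x \<in> bm_carpet n m \<Lambda>" unfolding K using t by blast
  qed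
qed

lemma continuous_on_digit_sum:
  fixes b :: nat and g :: "nat \<times> nat \<Rightarrow> nat"
  assumes "2 \<le> b" "\<And>d. d \<in> \<Lambda> \<Longrightarrow> g d < b" and fin: "finite \<Lambda>"
  shows "continuous_on {s. \<forall>k. s k \<in> \<Lambda>} (\<lambda>s. \<Sum>k. real (g (s k)) / real b ^ Suc k)"
proof (rule uniform_limit_theorem)
  let ?S = "{s. \<forall>k::nat. s k \<in> \<Lambda>}"
  have c: "continuous_on ?S (\<lambda>s. real (g (s k)))" for k
    by (rule continuous_on_compose2[where g = "\<lambda>d. real (g d)" and t = \<Lambda>])
       (rule continuous_on_finite[OF fin],
        rule continuous_on_subset[OF continuous_on_product_coordinates subset_UNIV], blast)
  show "\<forall>\<^sub>F N in sequentially. continuous_on ?S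
      (\<lambda>s. \<Sum>k<N. real (g (s k)) / real b ^ Suc k)"
    using assms(1) by (intro always_eventually allI continuous_intros c) auto
  show "uniform_limit ?S (\<lambda>N s. \<Sum>k<N. real (g (s k)) / real b ^ Suc k)
      (\<lambda>s. \<Sum>k. real (g (s k)) / real b ^ Suc k) sequentially"
    by (rule Weierstrass_m_test[OF _ summable_geom_inv[OF assms(1)]])
       (rule digit_bound[OF assms(1)], use assms(2) in auto)
qed simp

lemma compact_bm_carpet:
  assumes "bm_digits n m \<Lambda>"
  shows "compact (bm_carpet n m \<Lambda>)"
proof -
  let ?S = "{s. \<forall>k::nat. s k \<in> \<Lambda>}"
  have nm: "2 \<le> n" "2 \<le> m" and lt: "\<And>d. d \<in> \<Lambda> \<Longrightarrow> fst d < n" "\<And>d. d \<in> \<Lambda> \<Longrightarrow> snd d < m"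
    using assms by (auto simp: bm_digits_def)
  have "finite \<Lambda>" using assms unfolding bm_digits_def by (intro card_ge_0_finite) linarith
  then have "compact \<Lambda>" by (simp add: finite_imp_compact)
  then have "compactin (product_topology (\<lambda>_. euclidean) UNIV) (PiE UNIV (\<lambda>_::nat. \<Lambda>))"
    by (simp add: compactin_PiE)
  moreover have "PiE UNIV (\<lambda>_::nat. \<Lambda>) = ?S" by (auto simp: PiE_def Pi_def)
  ultimately have "compact ?S"
    by (simp add: euclidean_product_topology flip: compactin_euclidean_iff)
  moreover have "continuous_on ?S (\<lambda>s. (\<Sum>k. real (fst (s k)) / real n ^ Suc k,
      \<Sum>k. real (snd (s k)) / real m ^ Suc k))"
    by (intro continuous_on_Pair continuous_on_digit_sum nm lt \<open>finite \<Lambda>\<close>)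
  ultimately have "compact ((\<lambda>s. (\<Sum>k. real (fst (s k)) / real n ^ Suc k,
      \<Sum>k. real (snd (s k)) / real m ^ Suc k)) ` ?S)"
    by (rule compact_continuous_image[rotated])
  then show ?thesis by (simp add: bm_carpet_def image_Collect)
qed

lemma is_attractor_bm_carpet:
  assumes "bm_digits n m \<Lambda>"
  shows "is_attractor \<Lambda> (bm_map n m) (bm_carpet n m \<Lambda>)"
proof -
  have "\<Lambda> \<noteq> {}" using assms by (auto simp: bm_digits_def)
  then obtain d where "d \<in> \<Lambda>" by blast
  then have "bm_carpet n m \<Lambda> \<noteq> {}"
    unfolding bm_carpet_def by (auto intro!: exI[of _ "\<lambda>_. d"])
  then show ?thesis
    unfolding is_attractor_def by (intro conjI compact_bm_carpet bm_carpet_fixed assms)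
qed

lemma dist_bm_map_le:
  assumes "2 \<le> m" "m < n"
  shows "dist (bm_map n m d p) (bm_map n m d q) \<le> dist p q / 2"
proof -
  have s: "(x / real b)\<^sup>2 \<le> (x / 2)\<^sup>2" if "2 \<le> b" for x :: real and b :: nat
    unfolding power_divide using that by (intro divide_left_mono power_mono) auto
  have "bm_map n m d p - bm_map n m d q = ((fst p - fst q) / real n, (snd p - snd q) / real m)"
    by (simp add: bm_map_def diff_divide_distrib add_divide_distrib)
  then have "dist (bm_map n m d p) (bm_map n m d q)
      = sqrt (((fst p - fst q) / real n)\<^sup>2 + ((snd p - snd q) / real m)\<^sup>2)"
    by (simp add: dist_norm norm_Pair power_divide)
  also have "\<dots> \<le> sqrt (((fst p - fst q) / 2)\<^sup>2 + ((snd p - snd q) / 2)\<^sup>2)"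
    using assms by (intro real_sqrt_le_mono add_mono s) auto
  also have "\<dots> = norm ((1/2) *\<^sub>R (p - q))"
    by (simp add: norm_prod_def power_divide)
  finally show ?thesis by (simp add: dist_norm)
qed

lemma bm_attractor_subset:
  assumes "2 \<le> m" "m < n"
    and C: "is_attractor \<Lambda> (bm_map n m) C" and K: "is_attractor \<Lambda> (bm_map n m) K"
  shows "C \<subseteq> K"
proof -
  have cC: "compact C" "C \<noteq> {}" and cK: "closed K" "K \<noteq> {}"
    using C K by (auto simp: is_attractor_def compact_imp_closed)
  obtain x where x: "x \<in> C" "\<And>y. y \<in> C \<Longrightarrow> infdist y K \<le> infdist x K"
    using continuous_attains_sup[OF cC, of "\<lambda>x. infdist x K"]
    continuous_on_infdist[OF continuous_on_id] by blast
  obtain d y where y: "d \<in> \<Lambda>" "y \<in> C" "x = bm_map n m d y"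
    using x(1) C unfolding is_attractor_def by blast
  obtain z where z: "z \<in> K" "infdist y K = dist y z"
    using infdist_attains_inf[OF cK] by blast
  have "bm_map n m d z \<in> K" using K y(1) z(1) unfolding is_attractor_def by blast
  then have "infdist x K \<le> dist x (bm_map n m d z)" by (rule infdist_le)
  also have "\<dots> \<le> infdist y K / 2"
    unfolding y(3) z(2) by (rule dist_bm_map_le[OF assms(1,2)])
  also have "\<dots> \<le> infdist x K / 2" using x(2)[OF y(2)] by simp
  finally have "infdist x K \<le> 0" by simp
  then have "infdist w K = 0" if "w \<in> C" for w
    using x(2)[OF that] infdist_nonneg[of w K] by linarith
  then show ?thesis using in_closed_iff_infdist_zero[OF cK] by blast
qed

lemma is_attractor_bm_carpet_iff:
  assumes "bm_digits n m \<Lambda>"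
  shows "is_attractor \<Lambda> (bm_map n m) K \<longleftrightarrow> K = bm_carpet n m \<Lambda>"
proof
  have nm: "2 \<le> m" "m < n" using assms by (auto simp: bm_digits_def)
  assume "is_attractor \<Lambda> (bm_map n m) K"
  then show "K = bm_carpet n m \<Lambda>"
    using is_attractor_bm_carpet[OF assms] by (intro equalityI bm_attractor_subset[OF nm])
qed (simp add: is_attractor_bm_carpet[OF assms])

end

theory Submission
  imports Defs
begin

text \<open>
Let \<open>f\<close> be a similitude of ratio \<open>r\<close> with \<open>f ` K \<subseteq> K\<close>, and suppose that \<open>ln r / ln n\<close> is irrational.
As \<open>K\<close> is bounded, \<open>r < 1\<close>.  In complex notation \<open>f \<circ> f\<close> has the form \<open>z \<mapsto> \<mu> * z + a\<close> with
\<open>norm \<mu> = r\<^sup>2\<close>, so every power \<open>\<mu> ^ t\<close> maps \<open>K\<close> into itself, up to a translation.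

The contradiction comes from the line.  Let \<open>F\<close> be the attractor of the maps \<open>x \<mapsto> (x + d) / b\<close>
for a set of at least two, but not all, of the digits below \<open>b\<close>.  For \<open>u < 1\<close> close to 1 no
set \<open>u F + c\<close> is contained in \<open>F + \<int>\<close> (\<open>no_near_identity_copy\<close>): its gaps are too short to contain
the longest gaps of \<open>F + \<int>\<close>, and there is too little room between these.  On the other hand,
by incommensurability the numbers \<open>b ^ k * \<mu> ^ t\<close> accumulate at points \<open>v\<close> of the open unit disc as
close to 1 as desired (\<open>rescaled_powers_accumulate\<close>), and \<open>u = Re v\<close> is then just below 1.  It remains
to extract a one-dimensional inclusion with the factor \<open>u\<close> from the invariance of \<open>K\<close>.

If one of the \<open>m\<close> rows contains no digit, the projection of \<open>K\<close> to the vertical axis is a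
digit set \<open>C\<close> in base \<open>m\<close> with digits missing.  Deep cylinders of \<open>K\<close> are much higher than wide, so up
to a vanishing error the heights of their images under \<open>\<mu> ^ t\<close> form a copy of \<open>C\<close>, and
magnification by a power of \<open>m\<close> gives \<open>u C + c \<subseteq> C + \<int>\<close> (\<open>missing_row_no_self_similarity\<close>).  This shows
that \<open>ln r / ln m\<close> is rational, and so is \<open>ln r / ln n\<close>, since \<open>ln n / ln m\<close> is.

If every row contains a digit, heights are unrestricted, but this freedom can be exploited.  For
\<open>j < m\<close> the slice \<open>F\<^sub>j\<close> of \<open>K\<close> at height \<open>j / (m - 1)\<close> is the digit set of row \<open>j\<close> in base \<open>n\<close>.  Take
\<open>t\<close> and \<open>k\<close> with \<open>\<mu> ^ t\<close> of size about \<open>n ^ - k\<close>.  One can choose a cylinder of level \<open>l\<close> such that the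
heights of its image under \<open>\<mu> ^ t\<close> have arbitrarily prescribed digits at the levels
\<open>l + k + 1, \<dots>, l + k + U\<close>, provided that \<open>m ^ (k + U)\<close> is small compared with \<open>n ^ k\<close>
(\<open>cylinder_image_in_window\<close>).  As \<open>m < n\<close>, this permits \<open>U\<close> to tend to infinity with \<open>k\<close>.  If the prescribed
digits are all \<open>j\<close>, then the image, magnified by \<open>n ^ (l + k)\<close>, stays within \<open>n ^ - U\<close> of \<open>F\<^sub>j + \<int>\<close> in the
horizontal direction.  In the limit, \<open>u F\<^sub>i + c \<subseteq> F\<^sub>j + \<int>\<close> for \<^emph>\<open>any\<close> two rows \<open>i\<close> and \<open>j\<close>
(\<open>slice_contains_copy_of_slice\<close>).  For \<open>i = j\<close> this is impossible if row \<open>j\<close> has at least two but not all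
digits.  If there is no such row, some row has a single digit, so that \<open>F\<^sub>j\<close> is a point; then no row can
be full, and \<open>K\<close> is a graph over the vertical axis.  In that case the same choice of cylinders
shows that \<open>K\<close> lies in a vertical line (\<open>full_rows_no_self_similarity\<close>).
\<close>

section \<open>Digit sets on the line\<close>

definition int_translates :: "real set \<Rightarrow> real set" where
  "int_translates F = {x + of_int z | x z. x \<in> F}"

lemma int_translatesI: "x \<in> F \<Longrightarrow> x + of_int z \<in> int_translates F"
  by (auto simp: int_translates_def)

lemma int_translates_add_int:
  assumes "x \<in> int_translates F" shows "x + of_int z \<in> int_translates F"
proof -
  from assms obtain y w where "x = y + of_int w" "y \<in> F" by (auto simp: int_translates_def)
  then show ?thesis using int_translatesI[of y F "w + z"] by (simp add: add.assoc)
qed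

lemma closed_int_translates:
  assumes "compact F" shows "closed (int_translates F)"
proof -
  have "int_translates F = (\<Union>x\<in>F. \<Union>y\<in>\<int>. {x + y})"
    by (auto simp: int_translates_def Ints_def)
  then show ?thesis using compact_closed_sums[OF assms closed_Ints] by simp
qed

lemma infdist_add_int:
  "infdist (x + of_int z) (int_translates F) \<le> infdist x (int_translates F)"
proof (cases "int_translates F = {}")
  case False
  show ?thesis
    unfolding infdist_notempty[OF False]
  proof (rule cINF_mono)
    fix y assume "y \<in> int_translates F"
    then show "\<exists>y'\<in>int_translates F. dist (x + of_int z) y' \<le> dist x y"
      using int_translates_add_int[of y F z] by (intro bexI[of _ "y + of_int z"]) (auto simp: dist_real_def)
  qed (use False in \<open>auto intro: bdd_belowI[of _ 0]\<close>)
qed (simp add: infdist_def)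

text \<open>The translation parts of almost-inclusions need not converge, but only their fractional
parts matter for a set of period 1, and these have a convergent subsequence.\<close>

lemma affine_copy_limit:
  fixes u \<delta> :: "nat \<Rightarrow> real"
  assumes F: "compact F" "F \<noteq> {}" and u: "u \<longlonglongrightarrow> u0" and \<delta>: "\<delta> \<longlonglongrightarrow> 0"
    and near: "\<And>i. \<exists>c. \<forall>x\<in>S. infdist (u i * x + c) (int_translates F) \<le> \<delta> i"
  shows "\<exists>c. \<forall>x\<in>S. u0 * x + c \<in> int_translates F"
proof -
  let ?A = "int_translates F"
  have A: "closed ?A" "?A \<noteq> {}"
    using closed_int_translates[OF F(1)] F(2) int_translatesI by blast+
  have "\<exists>c\<in>{0..1}. \<forall>x\<in>S. infdist (u i * x + c) ?A \<le> \<delta> i" for i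
  proof -
    obtain c where c: "\<forall>x\<in>S. infdist (u i * x + c) ?A \<le> \<delta> i" using near by blast
    have "infdist (u i * x + frac c) ?A \<le> \<delta> i" if "x \<in> S" for x
      using infdist_add_int[of "u i * x + c" "- \<lfloor>c\<rfloor>" F] c that
      by (force simp: frac_def algebra_simps)
    then show ?thesis by (intro bexI[of _ "frac c"]) (auto simp: less_imp_le[OF frac_lt_1])
  qed
  then obtain c where c: "\<And>i. c i \<in> {0..1}"
    "\<And>i x. x \<in> S \<Longrightarrow> infdist (u i * x + c i) ?A \<le> \<delta> i" by metis
  obtain c0 \<phi> where \<phi>: "strict_mono \<phi>" "(c \<circ> \<phi>) \<longlonglongrightarrow> c0"
    using compact_imp_seq_compact[OF compact_Icc, of 0 "1::real"] c(1)
    unfolding seq_compact_def by blast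
  have "u0 * x + c0 \<in> ?A" if x: "x \<in> S" for x
  proof -
    have "(\<lambda>i. infdist ((u \<circ> \<phi>) i * x + (c \<circ> \<phi>) i) ?A) \<longlonglongrightarrow> infdist (u0 * x + c0) ?A"
      by (intro tendsto_infdist tendsto_intros \<phi> LIMSEQ_subseq_LIMSEQ u)
    moreover have "(\<delta> \<circ> \<phi>) \<longlonglongrightarrow> 0" by (rule LIMSEQ_subseq_LIMSEQ[OF \<delta> \<phi>(1)])
    ultimately have "infdist (u0 * x + c0) ?A \<le> 0"
      by (rule LIMSEQ_le) (use c(2)[OF x] in auto)
    then show ?thesis
      using in_closed_iff_infdist_zero[OF A] infdist_nonneg[of "u0 * x + c0" ?A] by simp
  qed
  then show ?thesis by blast
qed

text \<open>The compact set \<open>F\<close> of all numbers \<open>\<Sum>k. d k / b ^ Suc k\<close> with digits \<open>d k \<in> D\<close>, described by its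
self-similarity.  Both the coordinate projections of a carpet and certain horizontal slices
of it are of this form.\<close>

locale digit_set =
  fixes b :: nat and D :: "nat set" and F :: "real set"
  assumes base: "2 \<le> b" and digits: "D \<subseteq> {0..<b}"
    and attractor: "is_attractor D (\<lambda>d x. (x + real d) / real b) F"
begin

lemma compact: "compact F" and nonempty: "F \<noteq> {}"
  and step: "d \<in> D \<Longrightarrow> x \<in> F \<Longrightarrow> (x + real d) / real b \<in> F"
  and unstep: "x \<in> F \<Longrightarrow> \<exists>d\<in>D. \<exists>y\<in>F. x = (y + real d) / real b"
  using attractor unfolding is_attractor_def by blast+

lemma finite_digits: "finite D" using digits finite_subset by blast

lemma digits_nonempty: "D \<noteq> {}"
  using nonempty unstep by blast

definition lo :: real where "lo = real (Min D) / (real b - 1)"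
definition hi :: real where "hi = real (Max D) / (real b - 1)"

lemma lo_fixed: "(lo + real (Min D)) / real b = lo" and hi_fixed: "(hi + real (Max D)) / real b = hi"
  using base by (simp_all add: lo_def hi_def field_simps)

text \<open>An extremal point of \<open>F\<close> lies in an extremal first-level copy of \<open>F\<close>, which makes it the fixed
point of the corresponding map.\<close>

lemma lo_mem: "lo \<in> F" and lo_le: "x \<in> F \<Longrightarrow> lo \<le> x"
proof -
  have D: "Min D \<in> D" using finite_digits digits_nonempty by simp
  obtain a where a: "a \<in> F" "\<And>x. x \<in> F \<Longrightarrow> a \<le> x"
    using compact_attains_inf[OF compact nonempty] by blast
  obtain d y where d: "d \<in> D" "y \<in> F" "a = (y + real d) / real b" using unstep[OF a(1)] by blast
  have "real (Min D) \<le> real d" using d(1) finite_digits by simp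
  with d a(2)[OF d(2)] base have 1: "real (Min D) \<le> a * (real b - 1)" by (simp add: field_simps)
  have "a \<le> (a + real (Min D)) / real b" by (rule a(2)[OF step[OF D a(1)]])
  with base have "a * (real b - 1) \<le> real (Min D)" by (simp add: field_simps)
  with 1 base have "a = lo" unfolding lo_def by (simp add: field_simps)
  with a show "lo \<in> F" "x \<in> F \<Longrightarrow> lo \<le> x" by auto
qed

lemma hi_mem: "hi \<in> F" and le_hi: "x \<in> F \<Longrightarrow> x \<le> hi"
proof -
  have D: "Max D \<in> D" using finite_digits digits_nonempty by simp
  obtain a where a: "a \<in> F" "\<And>x. x \<in> F \<Longrightarrow> x \<le> a"
    using compact_attains_sup[OF compact nonempty] by blast
  obtain d y where d: "d \<in> D" "y \<in> F" "a = (y + real d) / real b" using unstep[OF a(1)] by blast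
  have "real d \<le> real (Max D)" using d(1) finite_digits by simp
  with d a(2)[OF d(2)] base have 1: "a * (real b - 1) \<le> real (Max D)" by (simp add: field_simps)
  have "(a + real (Max D)) / real b \<le> a" by (rule a(2)[OF step[OF D a(1)]])
  with base have "real (Max D) \<le> a * (real b - 1)" by (simp add: field_simps)
  with 1 base have "a = hi" unfolding hi_def by (simp add: field_simps)
  with a show "hi \<in> F" "x \<in> F \<Longrightarrow> x \<le> hi" by auto
qed

lemma lo_nonneg: "0 \<le> lo" and hi_le_1: "hi \<le> 1"
proof -
  show "0 \<le> lo" using base by (simp add: lo_def)
  have "Max D < b" using digits finite_digits digits_nonempty by (meson Max_in atLeastLessThan_iff subsetD)
  then show "hi \<le> 1" using base by (simp add: hi_def)
qed

lemma unit_interval: "x \<in> F \<Longrightarrow> 0 \<le> x \<and> x \<le> 1"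
  using lo_le le_hi lo_nonneg hi_le_1 by fastforce

lemma singleton_if_card_1:
  assumes "card D = 1" "x \<in> F" shows "x = lo"
proof -
  obtain d where "D = {d}" using assms(1) by (auto simp: card_1_singleton_iff)
  then have "Min D = d" "Max D = d" by simp_all
  then have "lo = hi" by (simp add: lo_def hi_def)
  then show ?thesis using lo_le le_hi assms(2) by fastforce
qed

text \<open>The first-level copies of \<open>F\<close> with digits \<open>i\<close> and \<open>i'\<close> have no other copy between them, so that
they bound a first-level gap, of length \<open>(i' - i - (hi - lo)) / b\<close>.\<close>

definition consecutive :: "nat \<Rightarrow> nat \<Rightarrow> bool" where
  "consecutive i i' \<longleftrightarrow> i \<in> D \<and> i' \<in> D \<and> i < i' \<and> (\<forall>e\<in>D. e \<le> i \<or> i' \<le> e)"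

lemma next_digit:
  assumes "i \<in> D" "i < Max D" shows "\<exists>i'. consecutive i i'"
proof -
  let ?S = "{e\<in>D. i < e}"
  have "?S \<noteq> {}" "finite ?S"
    using assms(2) finite_digits Max_in[OF finite_digits digits_nonempty] by auto
  then have "Min ?S \<in> ?S" "\<forall>e\<in>?S. Min ?S \<le> e" using Min_in by auto
  then show ?thesis using assms unfolding consecutive_def
    by (intro exI[of _ "Min ?S"]) (use not_less in auto)
qed

text \<open>No gap inside the convex hull of \<open>F\<close> is longer than the longest first-level gap: every other
gap is a copy of a first-level one, contracted by a power of \<open>b\<close>.\<close>

lemma gap_filling:
  assumes g: "0 < g" "\<And>i i'. consecutive i i' \<Longrightarrow> (real i' - real i - (hi - lo)) / real b \<le> g"
    and z: "lo \<le> z" "z \<le> hi"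
  shows "\<exists>x\<in>F. z \<le> x \<and> x \<le> z + g"
proof -
  \<comment> \<open>Descending \<open>N\<close> levels towards \<open>z\<close> either meets a first-level gap, contracted, or ends in a
    cell of length at most \<open>1 / b ^ N\<close>.\<close>
  have *: "\<exists>x\<in>F. z \<le> x \<and> x \<le> z + max g (1 / real b ^ N)" if "lo \<le> z" "z \<le> hi" for z N
    using that
  proof (induction N arbitrary: z)
    case 0
    then show ?case using hi_mem lo_nonneg hi_le_1 by (intro bexI[of _ hi]) auto
  next
    case (Suc N)
    let ?S = "{e\<in>D. (lo + real e) / real b \<le> z}"
    have "Min D \<in> ?S" using lo_fixed Suc.prems finite_digits digits_nonempty by simp
    then have ne: "?S \<noteq> {}" "finite ?S" using finite_digits by auto
    define i where "i = Max ?S"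
    have i: "i \<in> D" "(lo + real i) / real b \<le> z" using Max_in[OF ne(2,1)] by (auto simp: i_def)
    have bpos: "0 < real b" using base by simp
    show ?case
    proof (cases "z \<le> (hi + real i) / real b")
      case True
      have "lo \<le> z * b - i" "z * b - i \<le> hi" using True i(2) bpos by (simp_all add: field_simps)
      from Suc.IH[OF this] obtain x where x: "x \<in> F" "z * b - i \<le> x"
        "x \<le> z * b - i + max g (1 / real b ^ N)" by blast
      have "max g (1 / real b ^ N) / real b \<le> max g (1 / real b ^ Suc N)"
      proof -
        have "g \<le> g * real b" using g(1) base mult_le_cancel_left1[of g "real b"] by simp
        then have "g / real b \<le> g" using bpos by (simp add: field_simps)
        then show ?thesis by (auto simp: max_def field_simps)
      qed
      moreover have "(x + i) / b \<le> z + max g (1 / real b ^ N) / real b"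
        using divide_right_mono[OF x(3), of "real b"] bpos by (simp add: add_divide_distrib diff_divide_distrib)
      moreover have "z \<le> (x + i) / b" using x(2) bpos by (simp add: field_simps)
      ultimately show ?thesis using step[OF i(1) x(1)] by (intro bexI[of _ "(x+i)/b"]) linarith+
    next
      case False
      have "i \<noteq> Max D" using False hi_fixed Suc.prems by auto
      then have "i < Max D" using i(1) finite_digits by (simp add: le_neq_implies_less)
      then obtain i' where i': "consecutive i i'" using next_digit[OF i(1)] by blast
      have "i' \<notin> ?S" using i' Max_ge[OF ne(2)] unfolding consecutive_def i_def[symmetric] by force
      then have "z \<le> (lo + real i') / real b" using i' by (simp add: consecutive_def)
      moreover have "(lo + real i') / real b \<le> z + g"
      proof -
        have "(lo + real i') / real b = (hi + real i) / real b + (real i' - real i - (hi - lo)) / real b"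
          by (simp add: add_divide_distrib diff_divide_distrib)
        with g(2)[OF i'] False show ?thesis by linarith
      qed
      ultimately show ?thesis
        using step[of i', OF _ lo_mem] i' unfolding consecutive_def by fastforce
    qed
  qed
  obtain N where "1 / real b ^ N < g"
    using real_arch_pow_inv[OF g(1), of "1 / real b"] base by (auto simp: power_one_over)
  then show ?thesis using *[OF z, of N] by (auto simp: max_def split: if_splits)
qed

text \<open>The longest first-level gap is a genuine gap.  Its length could vanish only if the hull of \<open>F\<close>
were \<open>[0, 1]\<close> and all consecutive digits differed by one; but then every digit would occur.\<close>

lemma largest_consecutive_gap:
  assumes "2 \<le> card D" "card D < b"
  obtains i i' where "consecutive i i'" "hi - lo < real i' - real i"
    "\<And>e e'. consecutive e e' \<Longrightarrow> real e' - real e \<le> real i' - real i"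
proof -
  define P where "P = {(e, e'). consecutive e e'}"
  let ?h = "\<lambda>(e, e'). real e' - real e"
  have "P \<subseteq> D \<times> D" by (auto simp: P_def consecutive_def)
  then have fin: "finite P" using finite_digits finite_subset by blast
  have D: "Min D \<in> D" "Max D \<in> D" "\<And>d. d \<in> D \<Longrightarrow> Min D \<le> d \<and> d \<le> Max D"
    using finite_digits digits_nonempty by auto
  have "Min D < Max D"
  proof (rule ccontr)
    assume "\<not> ?thesis"
    then have "D \<subseteq> {Min D}" using D by force
    then have "card D \<le> 1" using card_mono[of "{Min D}" D] by simp
    then show False using assms by simp
  qed
  then have "P \<noteq> {}" using next_digit[OF D(1)] by (auto simp: P_def)
  then have "Max (?h ` P) \<in> ?h ` P" using fin by (intro Max_in) auto
  then obtain i i' where ii: "consecutive i i'" "Max (?h ` P) = real i' - real i"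
    by (auto simp: P_def)
  have max: "real e' - real e \<le> real i' - real i" if "consecutive e e'" for e e'
    unfolding ii(2)[symmetric] using fin that by (intro Max_ge) (auto simp: P_def image_iff)
  have "hi - lo < real i' - real i"
  proof (rule ccontr)
    assume "\<not> ?thesis"
    moreover have "1 \<le> real i' - real i" using ii(1) by (auto simp: consecutive_def)
    ultimately have 1: "real i' - real i \<le> 1" "lo = 0" "hi = 1"
      using lo_nonneg hi_le_1 by linarith+
    have "Min D = 0" "Suc (Max D) = b" using 1(2,3) base by (auto simp: lo_def hi_def field_simps)
    have "k \<in> D" if "k < b" for k
      using that
    proof (induction k)
      case 0
      then show ?case using D(1) \<open>Min D = 0\<close> by simp
    next
      case (Suc k)
      then obtain k' where k': "consecutive k k'" using next_digit[of k] \<open>Suc (Max D) = b\<close> by auto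
      then have "k' = Suc k" using max[OF k'] 1(1) by (auto simp: consecutive_def)
      then show ?case using k' by (simp add: consecutive_def)
    qed
    then have "D = {0..<b}" using digits by auto
    then show False using assms(2) by simp
  qed
  then show ?thesis using that ii(1) max by blast
qed

text \<open>Let \<open>(p, q)\<close> be a longest first-level gap.  Inside its hull, a copy \<open>u F + c\<close> with \<open>u < 1\<close> has
only gaps shorter than \<open>q - p\<close>, so if it lies in \<open>F + \<int>\<close>, its hull cannot contain a translate of \<open>(p, q)\<close> and fits
between two consecutive ones: into an interval of length \<open>1 - (q - p)\<close>.  If the outer gaps
\<open>(hi, lo + 1)\<close> are at least as long as \<open>(p, q)\<close>, the hull cannot contain them either and fits into
a translate of \<open>[q, hi]\<close> or of \<open>[lo, p]\<close>.  Either way the room, called \<open>w\<close> below, is strictly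
smaller than \<open>hi - lo\<close>, which forces \<open>u\<close> away from 1.\<close>

lemma no_near_identity_copy:
  assumes "2 \<le> card D" "card D < b"
  shows "\<exists>\<epsilon>>0. \<forall>u. 1 - \<epsilon> < u \<and> u < 1 \<longrightarrow> \<not> (\<exists>c. \<forall>x\<in>F. u * x + c \<in> int_translates F)"
proof -
  obtain i i' where i: "consecutive i i'" "hi - lo < real i' - real i"
    and max: "\<And>e e'. consecutive e e' \<Longrightarrow> real e' - real e \<le> real i' - real i"
    using largest_consecutive_gap[OF assms] by blast
  define p where "p = (hi + real i) / real b"
  define q where "q = (lo + real i') / real b"
  have bpos: "0 < real b" using base by simp
  have pq: "p \<in> F" "q \<in> F"
    using i(1) step hi_mem lo_mem by (auto simp: p_def q_def consecutive_def)
  have q_p: "q - p = (real i' - real i - (hi - lo)) / real b"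
    by (simp add: p_def q_def add_divide_distrib diff_divide_distrib)
  have less: "p < q" using i(2) bpos q_p by (smt (verit) divide_pos_pos)
  have bounds: "lo \<le> p" "q \<le> hi" using pq lo_le le_hi by auto
  let ?A = "int_translates F"
  have gap: "t \<le> p + of_int k \<or> q + of_int k \<le> t" if tA: "t \<in> ?A" for t k
  proof -
    obtain x z where x: "t = x + of_int z" "x \<in> F" using tA unfolding int_translates_def by blast
    obtain d y where d: "d \<in> D" "y \<in> F" "x = (y + real d) / real b" using unstep[OF x(2)] by blast
    have "x \<le> p \<or> q \<le> x"
    proof -
      have "d \<le> i \<or> i' \<le> d" using i(1) d(1) by (simp add: consecutive_def)
      then show ?thesis
        using lo_le[OF d(2)] le_hi[OF d(2)] bpos by (auto simp: d(3) p_def q_def divide_simps)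
    qed
    moreover have "0 \<le> p" "q \<le> 1" "0 \<le> x" "x \<le> 1" using unit_interval pq x(2) by auto
    moreover have "z = k \<or> real_of_int (k + 1) \<le> real_of_int z \<or> real_of_int (z + 1) \<le> real_of_int k"
      unfolding of_int_le_iff by arith
    ultimately show ?thesis unfolding x(1) by auto
  qed
  have outer: "t \<le> hi + of_int k \<or> lo + of_int k + 1 \<le> t" if tA: "t \<in> ?A" for t k
  proof -
    obtain x z where x: "t = x + of_int z" "x \<in> F" using tA unfolding int_translates_def by blast
    have "k + 1 \<le> z \<or> z \<le> k" by arith
    then have "real_of_int k + 1 \<le> real_of_int z \<or> real_of_int z \<le> real_of_int k"
      by (metis of_int_1 of_int_add of_int_le_iff)
    then show ?thesis unfolding x(1)
      by (elim disjE) (use lo_le[OF x(2)] le_hi[OF x(2)] in linarith)+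
  qed
  define w where "w = (if q - p \<le> 1 - (hi - lo) then max (hi - q) (p - lo) else 1 - (q - p))"
  have w: "0 \<le> w" "w < hi - lo" using bounds less lo_nonneg hi_le_1 by (auto simp: w_def)
  have "\<not> (\<exists>c. \<forall>x\<in>F. u * x + c \<in> ?A)" if u: "w / (hi - lo) < u" "u < 1" for u
  proof
    assume "\<exists>c. \<forall>x\<in>F. u * x + c \<in> ?A"
    then obtain c where c: "\<And>x. x \<in> F \<Longrightarrow> u * x + c \<in> ?A" by blast
    have wu: "w < u * hi - u * lo" using u(1) w by (simp add: field_simps)
    have "0 \<le> w / (hi - lo)" using w by simp
    then have u0: "0 < u" using u(1) by linarith
    define s where "s = u * lo + c"
    define t where "t = u * hi + c"
    have st: "s \<in> ?A" "t \<in> ?A" using c lo_mem hi_mem by (auto simp: s_def t_def)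
    have no_long_gap: "\<not> (s \<le> a \<and> a' \<le> t)"
      if "q - p \<le> a' - a" "\<And>x. x \<in> ?A \<Longrightarrow> x \<le> a \<or> a' \<le> x" for a a'
    proof
      assume a: "s \<le> a \<and> a' \<le> t"
      have "(q - p) * u < (q - p) * 1" using less u(2) by (intro mult_strict_left_mono) auto
      then have "q - p < (a' - a) / u" using that(1) u0 by (simp add: field_simps)
      then have "q - p < (a' - c) / u - (a - c) / u" by (simp add: diff_divide_distrib)
      moreover define e e' where "e = (a - c) / u" and "e' = (a' - c) / u"
      ultimately have len: "q - p < e' - e" by simp
      have e: "u * e + c = a" "u * e' + c = a'" using u0 by (simp_all add: e_def e'_def)
      define z where "z = (e + e' - (q - p)) / 2"
      have z1: "e < z" using len unfolding z_def by simp
      have z2: "z + (q - p) < e'" using len unfolding z_def by (simp add: field_simps)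
      have "lo \<le> e" "e' \<le> hi"
        using a u0 by (simp_all add: s_def t_def e_def e'_def field_simps)
      then have "lo \<le> z" "z \<le> hi" using z1 z2 less by linarith+
      moreover have "(real d' - real d - (hi - lo)) / real b \<le> q - p" if "consecutive d d'" for d d'
        unfolding q_p using max[OF that] bpos by (intro divide_right_mono) auto
      ultimately obtain x where x: "x \<in> F" "z \<le> x" "x \<le> z + (q - p)"
        using gap_filling[of "q - p" z] less by auto
      have "e < x" "x < e'" using x z1 z2 by linarith+
      then have "u * e + c < u * x + c" "u * x + c < u * e' + c" using u0 by simp_all
      then have "a < u * x + c" "u * x + c < a'" unfolding e by simp_all
      then show False using that(2)[OF c[OF x(1)]] by linarith
    qed
    \<comment> \<open>\<open>s\<close> and \<open>t\<close> are trapped between the gaps \<open>(p, q) + k\<close> and \<open>(p, q) + (k + 1)\<close>.\<close>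
    define k where "k = \<lfloor>s - q\<rfloor>"
    have k: "q + of_int k \<le> s" "s < q + of_int k + 1" unfolding k_def by linarith+
    have s_le: "s \<le> p + of_int k + 1" using gap[OF st(1), of "k + 1"] k by auto
    have t_le: "t \<le> p + of_int k + 1"
      using no_long_gap[where a = "p + of_int (k + 1)" and a' = "q + of_int (k + 1)"] gap[of _ "k + 1"]
        gap[OF st(2), of "k + 1"] s_le by auto
    have ts: "t - s = u * hi - u * lo" by (simp add: s_def t_def)
    show False
    proof (cases "q - p \<le> 1 - (hi - lo)")
      case True
      show False
      proof (cases "s \<le> hi + of_int k")
        case le: True
        then have "t \<le> hi + of_int k"
          using no_long_gap[where a = "hi + of_int k" and a' = "lo + of_int k + 1"] outer[of _ k] outer[OF st(2), of k]
            True by auto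
        then show False using k(1) ts wu True by (auto simp: w_def)
      next
        case False
        then have "lo + of_int k + 1 \<le> s" using outer[OF st(1), of k] by simp
        then show False using t_le ts wu True by (auto simp: w_def)
      qed
    next
      case False
      then show False using t_le k(1) ts wu by (auto simp: w_def)
    qed
  qed
  then show ?thesis
    using w by (intro exI[of _ "1 - w / (hi - lo)"]) (auto simp: field_simps)
qed

lemma scaled_mem_int_translates:
  "x \<in> F \<Longrightarrow> real b ^ L * x \<in> int_translates F"
proof (induction L arbitrary: x)
  case 0
  then show ?case using int_translatesI[of x F 0] by simp
next
  case (Suc L)
  obtain d y where d: "y \<in> F" "x = (y + real d) / real b" using unstep[OF Suc.prems] by blast
  have "real b ^ Suc L * x = real b ^ L * y + of_int (int (b ^ L * d))"
    using base by (simp add: d(2) field_simps)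
  then show ?case using int_translates_add_int[OF Suc.IH[OF d(1)]] by presburger
qed

end

section \<open>Rescaled powers of a complex number\<close>

text \<open>Rescaling \<open>\<mu> ^ t\<close> by a suitable power of \<open>b\<close> moves it into the compact annulus
\<open>1 / b < |z| \<le> 1\<close>.  The quotient of two close rescaled powers is again a rescaled power, and it
is close to 1.\<close>

lemma rescaled_powers_near_1:
  fixes \<mu> :: complex and b :: real
  assumes b: "1 < b" and \<mu>: "0 < norm \<mu>" "norm \<mu> < 1" and \<delta>: "0 < \<delta>"
  shows "\<exists>t\<ge>T. \<exists>k\<ge>T. norm (of_real b ^ k * \<mu> ^ t - 1) < \<delta>"
proof -
  define x where "x t = (1 / norm \<mu>) ^ t" for t
  have x1: "1 \<le> x t" for t
    unfolding x_def using \<mu> by (intro one_le_power) simp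
  define k where "k t = nat \<lfloor>log b (x t)\<rfloor>" for t
  have k: "b ^ k t \<le> x t" "x t < b ^ Suc (k t)" for t
  proof -
    have 0: "0 \<le> log b (x t)" using b x1[of t] by simp
    have "b powr real (k t) \<le> b powr log b (x t)"
      using b 0 by (intro powr_mono) (auto simp: k_def)
    then show "b ^ k t \<le> x t" using b x1[of t] by (simp add: powr_realpow)
    have "log b (x t) < real (Suc (k t))" using 0 unfolding k_def by simp linarith
    then have "b powr log b (x t) < b powr real (Suc (k t))" using b by (intro powr_less_mono) auto
    then show "x t < b ^ Suc (k t)" using b x1[of t] by (simp add: powr_realpow del: of_nat_Suc)
  qed
  define z where "z t = of_real b ^ k t * \<mu> ^ t" for t
  have norm_z: "norm (z t) = b ^ k t / x t" for t
    using b \<mu> by (simp add: z_def x_def norm_mult norm_power power_one_over)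
  have z_le: "norm (z t) \<le> 1" and z_ge: "1 / b < norm (z t)" for t
    using k[of t] x1[of t] b by (simp_all add: norm_z field_simps)
  have "seq_compact (cball (0::complex) 1)" by (intro compact_imp_seq_compact compact_cball)
  then obtain l \<phi> where \<phi>: "strict_mono \<phi>" "(z \<circ> \<phi>) \<longlonglongrightarrow> l"
    unfolding seq_compact_def using z_le by (meson mem_cball_0)
  have "Cauchy (z \<circ> \<phi>)" using \<phi>(2) LIMSEQ_imp_Cauchy by blast
  then obtain N where N: "\<And>i j. i \<ge> N \<Longrightarrow> j \<ge> N \<Longrightarrow> norm (z (\<phi> i) - z (\<phi> j)) < \<delta> / b"
    using CauchyD[of "z \<circ> \<phi>" "\<delta> / b"] \<delta> b by auto
  define s where "s = \<phi> N"
  have "1 < 1 / norm \<mu>" using \<mu> by simp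
  then obtain M where M: "b ^ (Suc (k s + T)) < (1 / norm \<mu>) ^ M" using real_arch_pow by blast
  define s' where "s' = \<phi> (N + s + T + M)"
  have s': "N + s + T + M \<le> s'" unfolding s'_def by (rule seq_suble[OF \<phi>(1)])
  have "(1 / norm \<mu>) ^ M \<le> x s'" unfolding x_def
    using \<mu> s' by (intro power_increasing) auto
  then have "b ^ (Suc (k s + T)) < b ^ Suc (k s')" using M k(2)[of s'] by linarith
  then have ks: "k s + T \<le> k s'" using b by simp
  have "z s * (of_real b ^ (k s' - k s) * \<mu> ^ (s' - s)) = z s'"
    using ks s' unfolding z_def by (simp add: power_add[symmetric] mult_ac flip: power_add)
  then have "z s * (of_real b ^ (k s' - k s) * \<mu> ^ (s' - s) - 1) = z s' - z s"
    by (simp add: algebra_simps)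
  then have "norm (z s) * norm (of_real b ^ (k s' - k s) * \<mu> ^ (s' - s) - 1) = norm (z s' - z s)"
    by (metis norm_mult)
  also have "\<dots> < \<delta> / b" using N[of "N + s + T + M" N] by (simp add: s_def s'_def)
  also have "\<dots> \<le> \<delta> * norm (z s)" using mult_left_mono[of "1 / b" "norm (z s)" \<delta>] z_ge[of s] \<delta> by simp
  finally have "norm (of_real b ^ (k s' - k s) * \<mu> ^ (s' - s) - 1) < \<delta>"
    using z_ge[of s] b by (smt (verit) mult.commute mult_less_cancel_left_pos zero_less_divide_1_iff)
  then show ?thesis using ks s' by (intro exI[of _ "s' - s"] conjI exI[of _ "k s' - k s"]) auto
qed

text \<open>By incommensurability a rescaled power \<open>w\<close> near 1 has modulus different from 1.  Since
rescaled powers return to 1 along sequences of exponents tending to infinity, both \<open>w\<close> and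
\<open>1 / w\<close> are limits of rescaled powers, and one of the two lies inside the unit disc.\<close>

lemma rescaled_powers_accumulate:
  fixes \<mu> :: complex and b :: real
  assumes b: "1 < b" and \<mu>: "0 < norm \<mu>" "norm \<mu> < 1" and \<delta>: "0 < \<delta>"
    and incomm: "\<And>k t. 0 < t \<Longrightarrow> b ^ k * norm \<mu> ^ t \<noteq> 1"
  obtains v and k t :: "nat \<Rightarrow> nat" where "norm v < 1" "norm (v - 1) < \<delta>"
    "filterlim k at_top sequentially"
    "(\<lambda>i. of_real b ^ k i * \<mu> ^ t i) \<longlonglongrightarrow> v"
proof -
  obtain t0 k0 where tk0: "1 \<le> t0" "norm (of_real b ^ k0 * \<mu> ^ t0 - 1) < \<delta>"
    using rescaled_powers_near_1[OF b \<mu> \<delta>, of 1] by blast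
  define w where "w = of_real b ^ k0 * \<mu> ^ t0"
  have w0: "w \<noteq> 0" using b \<mu> by (auto simp: w_def)
  have norm_w: "norm w \<noteq> 1"
    using incomm[of t0 k0] tk0(1) b by (simp add: w_def norm_mult norm_power)
  have "\<exists>t\<ge>i + t0 + k0. \<exists>k\<ge>i + t0 + k0. norm (of_real b ^ k * \<mu> ^ t - 1) < 1 / real (Suc i)" for i
    by (rule rescaled_powers_near_1[OF b \<mu>]) simp
  then obtain t k where tk: "\<And>i. i + t0 + k0 \<le> t i" "\<And>i. i + t0 + k0 \<le> k i"
    "\<And>i. norm (of_real b ^ k i * \<mu> ^ t i - 1) < 1 / real (Suc i)" by metis
  have lim: "(\<lambda>i. of_real b ^ k i * \<mu> ^ t i) \<longlonglongrightarrow> 1"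
  proof (rule Lim_transform_bound[where g = "\<lambda>i. 1 / real (Suc i)", THEN LIM_zero_cancel])
    show "\<forall>\<^sub>F i in sequentially. norm (of_real b ^ k i * \<mu> ^ t i - 1) \<le> norm (1 / real (Suc i))"
      using tk(3) by (intro always_eventually allI) (simp add: less_imp_le)
    show "(\<lambda>i. 1 / real (Suc i)) \<longlonglongrightarrow> 0" by (rule LIMSEQ_Suc[OF lim_1_over_n])
  qed
  have large: "filterlim h at_top sequentially" if "\<And>i. i \<le> h i" for h :: "nat \<Rightarrow> nat"
    by (rule filterlim_at_top_mono[OF filterlim_ident]) (use that in auto)
  show ?thesis
  proof (cases "norm w < 1")
    case True
    have "(\<lambda>i. of_real b ^ (k0 + k i) * \<mu> ^ (t0 + t i)) \<longlonglongrightarrow> w * 1"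
      using tendsto_mult[OF tendsto_const[of w] lim] by (simp add: w_def power_add mult_ac)
    moreover have "i \<le> k0 + k i" for i using tk(2)[of i] by auto
    ultimately show ?thesis 
      using that[of w "\<lambda>i. k0 + k i" "\<lambda>i. t0 + t i"] large True tk0(2) by (simp add: w_def)
  next
    case False
    then have w1: "1 < norm w" using norm_w by simp
    have eq: "of_real b ^ (k i - k0) * \<mu> ^ (t i - t0) = (of_real b ^ k i * \<mu> ^ t i) / w" for i
    proof -
      have "k0 + (k i - k0) = k i" "t0 + (t i - t0) = t i" using tk(1,2)[of i] by auto
      moreover have "w * (of_real b ^ (k i - k0) * \<mu> ^ (t i - t0))
          = of_real b ^ (k0 + (k i - k0)) * \<mu> ^ (t0 + (t i - t0))"
        unfolding w_def by (simp only: power_add mult_ac)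
      ultimately have "w * (of_real b ^ (k i - k0) * \<mu> ^ (t i - t0)) = of_real b ^ k i * \<mu> ^ t i"
        by simp
      then show ?thesis using w0 by (simp add: field_simps)
    qed
    have "(\<lambda>i. of_real b ^ (k i - k0) * \<mu> ^ (t i - t0)) \<longlonglongrightarrow> 1 / w"
      unfolding eq by (intro tendsto_intros lim w0)
    moreover have "i \<le> k i - k0" for i using tk(2)[of i] by auto
    moreover have "norm (1 / w) < 1" using w1 by (simp add: norm_divide divide_less_eq_1)
    moreover have "norm (1 / w - 1) < \<delta>"
    proof -
      have "1 / w - 1 = (1 - w) / w" using w0 by (simp add: field_simps)
      then have "norm (1 / w - 1) = norm (w - 1) / norm w" by (simp add: norm_divide norm_minus_commute)
      also have "\<dots> \<le> norm (w - 1) / 1" using w1 by (intro divide_left_mono) auto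
      finally show ?thesis using tk0(2) by (simp add: w_def)
    qed
    ultimately show ?thesis
      by (intro that[of "1 / w" "\<lambda>i. k i - k0" "\<lambda>i. t i - t0"] large) auto
  qed
qed

lemma ratio_power_small:
  assumes "0 < m" "m < n" "0 < (\<epsilon>::real)"
  shows "\<forall>\<^sub>F l in sequentially. C * (real m / real n) ^ l < \<epsilon>"
proof -
  have "(\<lambda>l. (real m / real n) ^ l) \<longlonglongrightarrow> 0" using assms by (intro LIMSEQ_realpow_zero) auto
  then have "(\<lambda>l. C * (real m / real n) ^ l) \<longlonglongrightarrow> C * 0"
    by (rule tendsto_mult[OF tendsto_const])
  then show ?thesis using assms(3) by (intro order_tendstoD(2)[of _ "C * 0"]) auto
qed

text \<open>Powers \<open>\<mu> ^ t\<close> of size about \<open>n ^ - k\<close> whose rescaling by \<open>n ^ k\<close> tends to a number just below 1.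
As \<open>m < n\<close>, the product \<open>m ^ k * |\<mu> ^ t|\<close>, comparable to \<open>(m / n) ^ k\<close>, tends to 0, so \<open>k\<close> can be
chosen so large that even \<open>m ^ (k + U) * Re (\<mu> ^ t)\<close> is small.  The number \<open>U\<close> is the count
of vertical digits that can be prescribed in the image of a cylinder under \<open>\<mu> ^ t\<close>.\<close>

lemma scales_of_prescribed_depth:
  fixes \<mu> :: complex
  assumes m: "2 \<le> m" "m < n" and \<mu>: "0 < norm \<mu>" "norm \<mu> < 1" and \<delta>: "0 < \<delta>" "\<delta> \<le> 1 / 2"
    and incomm: "\<And>k t. 0 < t \<Longrightarrow> real n ^ k * norm \<mu> ^ t \<noteq> 1"
  obtains u0 and k t :: "nat \<Rightarrow> nat" where "1 - \<delta> < u0" "u0 < 1"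
    "(\<lambda>U. real n ^ k U * Re (\<mu> ^ t U)) \<longlonglongrightarrow> u0"
    "\<And>U. 0 < Re (\<mu> ^ t U)" "\<And>U. 1 / 2 \<le> real n ^ k U * Re (\<mu> ^ t U)"
    "\<And>U. real m ^ (k U + U) * Re (\<mu> ^ t U) \<le> 1 / 4"
proof -
  have n1: "1 < real n" using m by simp
  obtain v and k t :: "nat \<Rightarrow> nat" where v: "norm v < 1" "norm (v - 1) < \<delta>"
    and k: "filterlim k at_top sequentially"
    and lim: "(\<lambda>i. of_real (real n) ^ k i * \<mu> ^ t i) \<longlonglongrightarrow> v"
    by (rule rescaled_powers_accumulate[OF n1 \<mu> \<delta>(1)], erule incomm, (rule that; assumption))
  define s where "s i = real n ^ k i * Re (\<mu> ^ t i)" for i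
  have "(\<lambda>i. Re (of_real (real n) ^ k i * \<mu> ^ t i)) \<longlonglongrightarrow> Re v" by (intro tendsto_Re lim)
  moreover have "Re (of_real (real n) ^ k i * \<mu> ^ t i) = s i" for i
    by (simp add: s_def flip: of_real_power)
  ultimately have s: "s \<longlonglongrightarrow> Re v" by simp
  have "Re v < 1" using complex_Re_le_cmod[of v] v(1) by linarith
  have "1 - Re v \<le> norm (v - 1)" using abs_Re_le_cmod[of "v - 1"] by simp
  then have "1 - \<delta> < Re v" using v(2) by linarith
  then have "1 / 2 < Re v" using \<delta> by linarith
  have "\<forall>U. \<exists>i. U \<le> i \<and> 1 / 2 < s i \<and> s i < 1 \<and> real m ^ U * (real m / real n) ^ k i < 1 / 4"
  proof
    fix U
    have "\<forall>\<^sub>F l in sequentially. real m ^ U * (real m / real n) ^ l < 1 / 4"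
      using m by (intro ratio_power_small) auto
    then have "\<forall>\<^sub>F i in sequentially. real m ^ U * (real m / real n) ^ k i < 1 / 4"
      by (rule eventually_compose_filterlim[OF _ k])
    then have "\<forall>\<^sub>F i in sequentially. U \<le> i \<and> 1 / 2 < s i \<and> s i < 1 \<and>
        real m ^ U * (real m / real n) ^ k i < 1 / 4"
      by (intro eventually_conj eventually_ge_at_top order_tendstoD(1)[OF s \<open>1 / 2 < Re v\<close>]
          order_tendstoD(2)[OF s \<open>Re v < 1\<close>])
    then show "\<exists>i. U \<le> i \<and> 1 / 2 < s i \<and> s i < 1 \<and> real m ^ U * (real m / real n) ^ k i < 1 / 4"
      by (rule eventually_happens'[OF sequentially_bot])
  qed
  from choice[OF this] obtain i where i: "\<And>U. U \<le> i U" "\<And>U. 1 / 2 < s (i U)" "\<And>U. s (i U) < 1"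
    "\<And>U. real m ^ U * (real m / real n) ^ k (i U) < 1 / 4" by blast
  have n0: "0 < real n" using m by simp
  have "filterlim i at_top sequentially"
    by (rule filterlim_at_top_mono[OF filterlim_ident]) (use i(1) in auto)
  then have "(\<lambda>U. s (i U)) \<longlonglongrightarrow> Re v" by (rule filterlim_compose[OF s])
  moreover have "0 < Re (\<mu> ^ t (i U))" for U
  proof -
    have "0 < real n ^ k (i U) * Re (\<mu> ^ t (i U))" using i(2)[of U] unfolding s_def by linarith
    then show ?thesis using n0 by (simp add: zero_less_mult_iff)
  qed
  moreover have "real m ^ (k (i U) + U) * Re (\<mu> ^ t (i U)) \<le> 1 / 4" for U
  proof -
    have "real m ^ (k (i U) + U) * Re (\<mu> ^ t (i U)) = real m ^ U * (real m / real n) ^ k (i U) * s (i U)"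
      using n0 by (simp add: s_def power_add power_divide)
    also have "\<dots> \<le> real m ^ U * (real m / real n) ^ k (i U) * 1"
      using i(3)[of U] by (intro mult_left_mono) auto
    finally show ?thesis using i(4)[of U] by linarith
  qed
  moreover have "1 / 2 \<le> real n ^ k (i U) * Re (\<mu> ^ t (i U))" for U using i(2)[of U] by (simp add: s_def)
  ultimately show ?thesis
    using that[of "Re v" "\<lambda>U. k (i U)" "\<lambda>U. t (i U)"] \<open>Re v < 1\<close> \<open>1 - \<delta> < Re v\<close> by (simp add: s_def)
qed

section \<open>Similitudes of the plane\<close>

text \<open>Multiplication by the complex number \<open>\<mu>\<close> followed by the translation by \<open>a\<close>, written in real
coordinates.\<close>

definition plane_similarity :: "complex \<Rightarrow> real \<times> real \<Rightarrow> real \<times> real \<Rightarrow> real \<times> real" where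
  "plane_similarity \<mu> a p =
     (Re \<mu> * fst p - Im \<mu> * snd p + fst a, Im \<mu> * fst p + Re \<mu> * snd p + snd a)"

lemma plane_similarity_comp:
  "plane_similarity \<mu> a (plane_similarity \<nu> c p) = plane_similarity (\<mu> * \<nu>) (plane_similarity \<mu> a c) p"
  by (simp add: plane_similarity_def algebra_simps)

text \<open>The square of an orthogonal map of the plane is a rotation: a reflection squares to the
identity.  Here \<open>k\<close> is the determinant, and \<open>\<nu>\<close> the rotation as a complex number.\<close>

lemma similitude_square:
  assumes "is_similitude r f"
  shows "\<exists>\<mu> a. norm \<mu> = r\<^sup>2 \<and> (\<forall>p. f (f p) = plane_similarity \<mu> a p)"
proof -
  obtain T a where T: "orthogonal_transformation T" and f: "\<And>x. f x = r *\<^sub>R T x + a"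
    using assms by (auto simp: is_similitude_def)
  have lin: "linear T" using T by (rule orthogonal_transformation_linear)
  have inner: "T x \<bullet> T y = x \<bullet> y" for x y using T unfolding orthogonal_transformation_def by blast
  obtain p q s t where pq: "T (1, 0) = (p, q)" and st: "T (0, 1) = (s, t)" by (metis surj_pair)
  have T_eq: "T (x, y) = (p * x + s * y, q * x + t * y)" for x y
  proof -
    have "T (x *\<^sub>R (1, 0) + y *\<^sub>R (0, 1)) = x *\<^sub>R T (1, 0) + y *\<^sub>R T (0, 1)"
      by (simp only: linear_add[OF lin] linear_scale[OF lin])
    then show ?thesis by (simp add: pq st mult.commute)
  qed
  have eqs: "p * p + q * q = 1" "s * s + t * t = 1" "p * s + q * t = 0"
    using inner[of "(1,0)" "(1,0)"] inner[of "(0,1)" "(0,1)"] inner[of "(1,0)" "(0,1)"]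
    by (simp_all add: pq st)
  define k where "k = p * t - q * s"
  have k: "s = - q * k" "t = p * k"
  proof -
    have "- q * k = q * q * s - p * (q * t)" by (simp add: k_def algebra_simps)
    also have "q * t = - (p * s)" using eqs(3) by simp
    also have "q * q * s - p * (- (p * s)) = (p * p + q * q) * s" by (simp add: algebra_simps)
    finally show "s = - q * k" by (simp add: eqs(1))
    have "p * k = p * p * t - q * (p * s)" by (simp add: k_def algebra_simps)
    also have "p * s = - (q * t)" using eqs(3) by simp
    also have "p * p * t - q * (- (q * t)) = (p * p + q * q) * t" by (simp add: algebra_simps)
    finally show "t = p * k" by (simp add: eqs(1))
  qed
  have "s * s + t * t = (p * p + q * q) * (k * k)" unfolding k by (simp add: algebra_simps)
  then have "k * k = 1" using eqs(1,2) by simp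
  then have "(k - 1) * (k + 1) = 0" by (simp add: algebra_simps)
  then have "k = 1 \<or> k = - 1" by auto
  then obtain \<nu> where \<nu>: "norm \<nu> = 1" "\<And>x. T (T x) = plane_similarity \<nu> 0 x"
  proof
    assume "k = 1"
    then have "s = - q" "t = p" using k by auto
    then have "T (T (x, y)) = plane_similarity (Complex (p * p - q * q) (2 * p * q)) 0 (x, y)" for x y
      by (simp add: T_eq plane_similarity_def algebra_simps)
    moreover have "(p * p - q * q)\<^sup>2 + (2 * p * q)\<^sup>2 = (p * p + q * q)\<^sup>2"
      by (simp add: algebra_simps power2_eq_square)
    then have "norm (Complex (p * p - q * q) (2 * p * q)) = 1"
      by (simp add: cmod_def eqs(1))
    ultimately show ?thesis
      using that[of "Complex (p * p - q * q) (2 * p * q)"] by auto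
  next
    assume "k = - 1"
    then have "s = q" "t = - p" using k by auto
    then have "T (T (x, y)) = ((p * p + q * q) * x, (p * p + q * q) * y)" for x y
      by (simp add: T_eq algebra_simps)
    then have "T (T x) = plane_similarity 1 0 x" for x
      by (cases x) (simp add: plane_similarity_def eqs(1))
    then show ?thesis using that[of 1] by simp
  qed
  have "f (f x) = plane_similarity (of_real (r\<^sup>2) * \<nu>) (f a) x" for x
  proof -
    have "f (f x) = r\<^sup>2 *\<^sub>R T (T x) + f a"
      by (simp only: f linear_add[OF lin] linear_scale[OF lin] scaleR_add_right scaleR_scaleR
          power2_eq_square add.assoc)
    then show ?thesis
      by (simp add: \<nu>(2) plane_similarity_def right_diff_distrib distrib_left mult.assoc prod_eq_iff)
  qed
  then show ?thesis
    using \<nu>(1) by (intro exI[of _ "of_real (r\<^sup>2) * \<nu>"] exI[of _ "f a"]) (simp add: norm_mult norm_power)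
qed

lemma plane_similarity_iterate:
  assumes "plane_similarity \<mu> a ` K \<subseteq> K"
  shows "\<exists>c. plane_similarity (\<mu> ^ t) c ` K \<subseteq> K"
proof (induction t)
  case 0
  have "plane_similarity 1 0 p = p" for p by (simp add: plane_similarity_def)
  then show ?case by (intro exI[of _ 0]) auto
next
  case (Suc t)
  then obtain c where c: "plane_similarity (\<mu> ^ t) c ` K \<subseteq> K" by blast
  have "plane_similarity (\<mu> ^ Suc t) (plane_similarity \<mu> a c) p
      = plane_similarity \<mu> a (plane_similarity (\<mu> ^ t) c p)" for p
    by (simp add: plane_similarity_comp)
  then show ?case using c assms by (intro exI[of _ "plane_similarity \<mu> a c"]) (auto simp: image_subset_iff)
qed

lemma norm_plane_similarity_diff:
  "norm (plane_similarity \<mu> a p - plane_similarity \<mu> a q) = norm \<mu> * norm (p - q)"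
proof -
  define x y where "x = fst p - fst q" and "y = snd p - snd q"
  have "plane_similarity \<mu> a p - plane_similarity \<mu> a q = (Re \<mu> * x - Im \<mu> * y, Im \<mu> * x + Re \<mu> * y)"
    by (simp add: plane_similarity_def x_def y_def right_diff_distrib)
  moreover have "(Re \<mu> * x - Im \<mu> * y)\<^sup>2 + (Im \<mu> * x + Re \<mu> * y)\<^sup>2 = ((Re \<mu>)\<^sup>2 + (Im \<mu>)\<^sup>2) * (x\<^sup>2 + y\<^sup>2)"
    by (simp add: power2_diff power2_sum power_mult_distrib distrib_left distrib_right)
  ultimately have "norm (plane_similarity \<mu> a p - plane_similarity \<mu> a q)
      = sqrt ((Re \<mu>)\<^sup>2 + (Im \<mu>)\<^sup>2) * sqrt (x\<^sup>2 + y\<^sup>2)"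
    by (simp add: norm_Pair real_sqrt_mult)
  moreover have "p - q = (x, y)" by (simp add: x_def y_def prod_eq_iff)
  ultimately show ?thesis by (simp add: norm_Pair cmod_def)
qed

text \<open>Iteration would blow up the distance of two points of \<open>K\<close> without bound.\<close>

lemma self_similarity_not_expanding:
  assumes "plane_similarity \<mu> a ` K \<subseteq> K" "bounded K" "p \<in> K" "q \<in> K" "p \<noteq> q"
  shows "norm \<mu> \<le> 1"
proof (rule ccontr)
  assume big: "\<not> norm \<mu> \<le> 1"
  obtain B where B: "\<And>x. x \<in> K \<Longrightarrow> norm x \<le> B" using assms(2) by (auto simp: bounded_iff)
  obtain t where t: "2 * B / norm (p - q) < norm \<mu> ^ t"
    using real_arch_pow[of "norm \<mu>"] big by auto
  obtain c where c: "plane_similarity (\<mu> ^ t) c ` K \<subseteq> K" using plane_similarity_iterate[OF assms(1)] by blast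
  have "norm \<mu> ^ t * norm (p - q) = norm (plane_similarity (\<mu> ^ t) c p - plane_similarity (\<mu> ^ t) c q)"
    by (simp add: norm_plane_similarity_diff norm_power)
  also have "\<dots> \<le> B + B"
    by (intro order_trans[OF norm_triangle_ineq4] add_mono B subsetD[OF c] imageI assms)
  finally have "norm \<mu> ^ t * norm (p - q) \<le> 2 * B" by simp
  moreover have "2 * B < norm \<mu> ^ t * norm (p - q)"
    using t assms(5) pos_divide_less_eq[of "norm (p - q)" "2 * B" "norm \<mu> ^ t"] by simp
  ultimately show False by linarith
qed

section \<open>Carpets with a missing row\<close>

locale carpet =
  fixes n m :: nat and \<Lambda> :: "(nat \<times> nat) set" and K :: "(real \<times> real) set"
  assumes m: "2 \<le> m" and mn: "m < n" and digits: "\<Lambda> \<subseteq> {0..<n} \<times> {0..<m}"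
    and attractor: "is_attractor \<Lambda> (bm_map n m) K"
begin

lemma compact: "compact K" and nonempty: "K \<noteq> {}" and K_eq: "K = (\<Union>d\<in>\<Lambda>. bm_map n m d ` K)"
  using attractor by (auto simp: is_attractor_def)

lemma pos: "0 < real m" "0 < real n"
  using m mn by auto

lemma step: "(i, j) \<in> \<Lambda> \<Longrightarrow> (x, y) \<in> K \<Longrightarrow> ((x + real i) / real n, (y + real j) / real m) \<in> K"
  by (subst K_eq) (force simp: bm_map_def)

lemma unstep:
  assumes "(x, y) \<in> K"
  obtains i j x' y' where "(i, j) \<in> \<Lambda>" "(x', y') \<in> K" "x = (x' + real i) / real n" "y = (y' + real j) / real m"
  using assms by (subst (asm) K_eq) (auto simp: bm_map_def)

sublocale columns: digit_set n "fst ` \<Lambda>" "fst ` K"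
proof
  show "is_attractor (fst ` \<Lambda>) (\<lambda>d x. (x + real d) / real n) (fst ` K)"
    unfolding is_attractor_def
  proof (intro conjI)
    show "compact (fst ` K)" by (intro compact_continuous_image continuous_on_fst continuous_on_id compact)
    show "fst ` K = (\<Union>d\<in>fst ` \<Lambda>. (\<lambda>x. (x + real d) / real n) ` fst ` K)"
    proof safe
      fix x y assume "(x, y) \<in> K"
      then show "fst (x, y) \<in> (\<Union>d\<in>fst ` \<Lambda>. (\<lambda>x. (x + real d) / real n) ` fst ` K)"
        by (rule unstep) force
    next
      fix i j x y assume "(i, j) \<in> \<Lambda>" "(x, y) \<in> K"
      from step[OF this] show "(fst (x, y) + real (fst (i, j))) / real n \<in> fst ` K" by force
    qed
  qed (use nonempty in auto)
qed (use m mn digits in auto)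

sublocale rows: digit_set m "snd ` \<Lambda>" "snd ` K"
proof
  show "is_attractor (snd ` \<Lambda>) (\<lambda>d x. (x + real d) / real m) (snd ` K)"
    unfolding is_attractor_def
  proof (intro conjI)
    show "compact (snd ` K)" by (intro compact_continuous_image continuous_on_snd continuous_on_id compact)
    show "snd ` K = (\<Union>d\<in>snd ` \<Lambda>. (\<lambda>x. (x + real d) / real m) ` snd ` K)"
    proof safe
      fix x y assume "(x, y) \<in> K"
      then show "snd (x, y) \<in> (\<Union>d\<in>snd ` \<Lambda>. (\<lambda>x. (x + real d) / real m) ` snd ` K)"
        by (rule unstep) force
    next
      fix i j x y assume "(i, j) \<in> \<Lambda>" "(x, y) \<in> K"
      from step[OF this] show "(snd (x, y) + real (snd (i, j))) / real m \<in> snd ` K" by force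
    qed
  qed (use nonempty in auto)
qed (use m mn digits in auto)

lemma unit_square: "(x, y) \<in> K \<Longrightarrow> 0 \<le> x \<and> x \<le> 1" "(x, y) \<in> K \<Longrightarrow> 0 \<le> y \<and> y \<le> 1"
  using columns.unit_interval[of x] rows.unit_interval[of y] by force+

text \<open>\<open>K\<close> contains copies of itself contracted by \<open>n ^ l\<close> horizontally and by \<open>m ^ l\<close> vertically; at
deep levels such a copy is arbitrarily elongated in the vertical direction.\<close>

lemma cylinder:
  "\<exists>\<xi> \<zeta>. \<forall>x y. (x, y) \<in> K \<longrightarrow> (x / real n ^ l + \<xi>, y / real m ^ l + \<zeta>) \<in> K"
proof (induction l)
  case 0
  show ?case by (intro exI[of _ 0]) simp
next
  case (Suc l)
  then obtain \<xi> \<zeta> where IH: "\<And>x y. (x, y) \<in> K \<Longrightarrow> (x / real n ^ l + \<xi>, y / real m ^ l + \<zeta>) \<in> K" by blast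
  obtain i j where d: "(i, j) \<in> \<Lambda>" using nonempty by (metis ex_in_conv surj_pair unstep)
  show ?case
  proof (intro exI allI impI)
    fix x y assume "(x, y) \<in> K"
    from step[OF d IH[OF this]]
    show "(x / real n ^ Suc l + (\<xi> + real i) / real n, y / real m ^ Suc l + (\<zeta> + real j) / real m) \<in> K"
      by (simp add: add_divide_distrib mult.commute add.assoc)
  qed
qed

text \<open>Apply \<open>\<mu> ^ t\<close> to cylinders of level \<open>l\<close> and look at heights, magnified by \<open>m ^ (k + l)\<close>.  The
contribution of the horizontal coordinate is of order \<open>(m / n) ^ l\<close> and disappears as \<open>l\<close> tends
to infinity.  What remains is a copy of the projection \<open>snd ` K\<close>, scaled by \<open>m ^ k * Re (\<mu> ^ t)\<close>,
inside the integer translates of this projection.\<close>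

lemma missing_row_no_self_similarity:
  assumes missing: "snd ` \<Lambda> \<noteq> {0..<m}"
    and inv: "plane_similarity \<mu> a ` K \<subseteq> K" and \<mu>: "0 < norm \<mu>" "norm \<mu> < 1"
    and incomm: "\<And>k t. 0 < t \<Longrightarrow> real m ^ k * norm \<mu> ^ t \<noteq> 1"
    and tall: "y \<in> snd ` K" "y' \<in> snd ` K" "y \<noteq> y'"
  shows False
proof -
  have "card (snd ` \<Lambda>) \<noteq> 1"
    using rows.singleton_if_card_1[OF _ tall(1)] rows.singleton_if_card_1[OF _ tall(2)] tall(3) by auto
  moreover have "card (snd ` \<Lambda>) \<noteq> 0" using rows.finite_digits rows.digits_nonempty by simp
  ultimately have c2: "2 \<le> card (snd ` \<Lambda>)" by linarith
  have "snd ` \<Lambda> \<subset> {0..<m}" using missing rows.digits by blast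
  then have "card (snd ` \<Lambda>) < card {0..<m}" by (rule psubset_card_mono[OF finite_atLeastLessThan])
  then have cm: "card (snd ` \<Lambda>) < m" by simp
  let ?A = "int_translates (snd ` K)"
  obtain \<epsilon> where \<epsilon>: "0 < \<epsilon>" "\<forall>u. 1 - \<epsilon> < u \<and> u < 1 \<longrightarrow> \<not> (\<exists>c. \<forall>x\<in>snd ` K. u * x + c \<in> ?A)"
    using rows.no_near_identity_copy[OF c2 cm] by (elim exE conjE)
  have m1: "1 < real m" using m by simp
  obtain v and k t :: "nat \<Rightarrow> nat" where v: "norm v < 1" "norm (v - 1) < \<epsilon>"
    and lim: "(\<lambda>i. of_real (real m) ^ k i * \<mu> ^ t i) \<longlonglongrightarrow> v"
    by (rule rescaled_powers_accumulate[OF m1 \<mu> \<epsilon>(1)], erule incomm, (rule that; assumption))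
  have "\<forall>\<^sub>F i in sequentially. norm (of_real (real m) ^ k i * \<mu> ^ t i) < 1 \<and>
      norm (of_real (real m) ^ k i * \<mu> ^ t i - 1) < \<epsilon>"
    by (intro eventually_conj order_tendstoD(2)[OF tendsto_norm[OF lim] v(1)]
        order_tendstoD(2)[OF tendsto_norm[OF tendsto_diff[OF lim tendsto_const]] v(2)])
  from eventually_happens'[OF sequentially_bot this]
  obtain i where i: "norm (of_real (real m) ^ k i * \<mu> ^ t i) < 1" "norm (of_real (real m) ^ k i * \<mu> ^ t i - 1) < \<epsilon>"
    by blast
  obtain a where inv_t: "plane_similarity (\<mu> ^ t i) a ` K \<subseteq> K" using plane_similarity_iterate[OF inv] by blast
  define R I where "R = Re (\<mu> ^ t i)" and "I = Im (\<mu> ^ t i)"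
  define u where "u = real m ^ k i * R"
  have u_eq: "u = Re (of_real (real m) ^ k i * \<mu> ^ t i)"
    by (simp add: u_def R_def flip: of_real_power)
  have "u < 1" using complex_Re_le_cmod i(1) unfolding u_eq by (rule le_less_trans)
  moreover have "1 - \<epsilon> < u"
    using abs_Re_le_cmod[of "of_real (real m) ^ k i * \<mu> ^ t i - 1"] i(2) unfolding u_eq by simp
  moreover have "\<exists>c. \<forall>y\<in>snd ` K. u * y + c \<in> ?A"
  proof (rule affine_copy_limit[OF rows.compact rows.nonempty tendsto_const])
    show "(\<lambda>l. \<bar>real m ^ k i * I\<bar> * (real m / real n) ^ l) \<longlonglongrightarrow> 0"
    proof -
      have "(\<lambda>l. (real m / real n) ^ l) \<longlonglongrightarrow> 0" using mn by (intro LIMSEQ_realpow_zero) auto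
      from tendsto_mult[OF tendsto_const[of "\<bar>real m ^ k i * I\<bar>"] this] show ?thesis by simp
    qed
    fix l
    obtain \<xi> \<zeta> where cyl: "\<And>x y. (x, y) \<in> K \<Longrightarrow> (x / real n ^ l + \<xi>, y / real m ^ l + \<zeta>) \<in> K"
      using cylinder[of l] by blast
    define c where "c = real m ^ (k i + l) * (I * \<xi> + R * \<zeta> + snd a)"
    have "infdist (u * y + c) ?A \<le> \<bar>real m ^ k i * I\<bar> * (real m / real n) ^ l" if "y \<in> snd ` K" for y
    proof -
      obtain x where xy: "(x, y) \<in> K" using \<open>y \<in> snd ` K\<close> by force
      let ?Y = "I * (x / real n ^ l + \<xi>) + R * (y / real m ^ l + \<zeta>) + snd a"
      have "plane_similarity (\<mu> ^ t i) a (x / real n ^ l + \<xi>, y / real m ^ l + \<zeta>) \<in> K"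
        by (rule subsetD[OF inv_t imageI[OF cyl[OF xy]]])
      from imageI[OF this, of snd] have "?Y \<in> snd ` K"
        by (simp only: plane_similarity_def fst_conv snd_conv R_def I_def)
      then have mem: "real m ^ (k i + l) * ?Y \<in> ?A" by (rule rows.scaled_mem_int_translates)
      have "M * (I * (p + \<xi>) + R * (q + \<zeta>) + snd a) = M * R * q + M * (I * \<xi> + R * \<zeta> + snd a) + M * I * p" for M p q
        by (simp add: algebra_simps)
      from this[of "real m ^ (k i + l)" "x / real n ^ l" "y / real m ^ l"]
      have "real m ^ (k i + l) * ?Y = u * y + c + real m ^ k i * I * (real m / real n) ^ l * x"
        using pos by (simp add: c_def u_def power_add power_divide)
      then have "dist (u * y + c) (real m ^ (k i + l) * ?Y) = \<bar>real m ^ k i * I\<bar> * (real m / real n) ^ l * \<bar>x\<bar>"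
        by (simp add: dist_real_def abs_mult)
      also have "\<dots> \<le> \<bar>real m ^ k i * I\<bar> * (real m / real n) ^ l * 1"
        using unit_square(1)[OF xy] by (intro mult_left_mono) auto
      finally show ?thesis using infdist_le2[OF mem] by simp
    qed
    then show "\<exists>c. \<forall>y\<in>snd ` K. infdist (u * y + c) ?A \<le> \<bar>real m ^ k i * I\<bar> * (real m / real n) ^ l" by blast
  qed
  ultimately show False using \<epsilon>(2)[rule_format, of u] by blast
qed

end

section \<open>Slices of a carpet\<close>

context carpet
begin

lemma fixed_point_mem:
  assumes "(i, j) \<in> \<Lambda>"
  shows "(real i / (real n - 1), real j / (real m - 1)) \<in> K"
proof -
  let ?e = "(real i / (real n - 1), real j / (real m - 1))"
  have e: "bm_map n m (i, j) ?e = ?e" using m mn by (simp add: bm_map_def field_simps)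
  have cK: "closed K" using compact by (rule compact_imp_closed)
  obtain z where z: "z \<in> K" "infdist ?e K = dist ?e z" using infdist_attains_inf[OF cK nonempty] by blast
  have "bm_map n m (i, j) z \<in> K" using assms z(1) by (subst K_eq) blast
  then have "infdist ?e K \<le> dist (bm_map n m (i, j) ?e) (bm_map n m (i, j) z)"
    using infdist_le e by metis
  also have "\<dots> \<le> infdist ?e K / 2" unfolding z(2) by (rule dist_bm_map_le[OF m mn])
  finally have "infdist ?e K = 0" using infdist_nonneg[of ?e K] by simp
  then show ?thesis using in_closed_iff_infdist_zero[OF cK nonempty] by blast
qed

text \<open>The height \<open>j / (m - 1)\<close> has \<open>j j j \<dots>\<close> as its only expansion in base \<open>m\<close>, even for \<open>j = 0\<close> and
\<open>j = m - 1\<close>, because expansions represent numbers of \<open>[0, 1]\<close> only.  Hence the slice of \<open>K\<close> at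
this height is exactly the digit set of row \<open>j\<close> in base \<open>n\<close>.\<close>

definition slice_digits :: "nat \<Rightarrow> nat set" where "slice_digits j = {i. (i, j) \<in> \<Lambda>}"
definition slice :: "nat \<Rightarrow> real set" where "slice j = {x. (x, real j / (real m - 1)) \<in> K}"

lemma slice_digit_set:
  assumes "j \<in> snd ` \<Lambda>"
  shows "digit_set n (slice_digits j) (slice j)"
proof
  let ?y = "real j / (real m - 1)"
  have y: "(?y + real j) / real m = ?y" using m by (simp add: field_simps)
  have j: "j < m" using assms digits by auto
  have y01: "0 \<le> ?y" "?y \<le> 1" using m j by (auto simp: field_simps)
  show "is_attractor (slice_digits j) (\<lambda>d x. (x + real d) / real n) (slice j)"
    unfolding is_attractor_def
  proof (intro conjI)
    have "slice j = fst ` (K \<inter> {p. snd p = ?y})" by (force simp: slice_def)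
    moreover have "closed {p :: real \<times> real. snd p = ?y}"
      by (intro closed_Collect_eq continuous_intros)
    ultimately show "compact (slice j)"
      using compact by (auto intro!: compact_continuous_image continuous_on_fst continuous_on_id)
    show "slice j \<noteq> {}" using assms fixed_point_mem by (force simp: slice_def)
    show "slice j = (\<Union>d\<in>slice_digits j. (\<lambda>x. (x + real d) / real n) ` slice j)"
    proof safe
      fix x assume "x \<in> slice j"
      then have "(x, ?y) \<in> K" by (simp add: slice_def)
      then obtain i j' x' y' where d: "(i, j') \<in> \<Lambda>" "(x', y') \<in> K" "x = (x' + real i) / real n"
        "?y = (y' + real j') / real m" by (rule unstep)
      have eq: "y' + real j' = ?y + real j" using d(4) y pos by (simp add: field_simps)
      have "0 \<le> y'" "y' \<le> 1" using unit_square d(2) by blast+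
      then have "j' = j \<or> (j' = Suc j \<and> ?y = 1) \<or> (j = Suc j' \<and> ?y = 0)" using eq y01 by linarith
      then have "j' = j"
      proof (elim disjE conjE)
        assume "j' = Suc j" "?y = 1"
        then have "j' = m" using m by (simp add: field_simps)
        then show ?thesis using d(1) digits by auto
      next
        assume "j = Suc j'" "?y = 0"
        then show ?thesis using m by simp
      qed
      then show "x \<in> (\<Union>d\<in>slice_digits j. (\<lambda>x. (x + real d) / real n) ` slice j)"
        using d eq by (auto simp: slice_digits_def slice_def)
    next
      fix i x assume "i \<in> slice_digits j" "x \<in> slice j"
      then show "(x + real i) / real n \<in> slice j"
        using step[of i j x ?y] y by (simp add: slice_digits_def slice_def)
    qed
  qed
qed (use m mn digits in \<open>auto simp: slice_digits_def\<close>)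

text \<open>Magnifying \<open>K\<close> by \<open>n ^ L\<close> and \<open>m ^ L\<close> reproduces \<open>K\<close> up to integer translations.\<close>

lemma shift:
  "(x, y) \<in> K \<Longrightarrow> \<exists>x' y' (z::int) (w::int). (x', y') \<in> K \<and>
     real n ^ L * x = x' + of_int z \<and> real m ^ L * y = y' + of_int w"
proof (induction L arbitrary: x y)
  case 0
  then show ?case by (intro exI[of _ x] exI[of _ y] exI[of _ 0]) simp
next
  case (Suc L)
  obtain i j x1 y1 where d: "(x1, y1) \<in> K" "x = (x1 + real i) / real n" "y = (y1 + real j) / real m"
    using Suc.prems by (rule unstep)
  from Suc.IH[OF d(1)] obtain x' y' z w where IH: "(x', y') \<in> K"
    "real n ^ L * x1 = x' + of_int z" "real m ^ L * y1 = y' + of_int w" by blast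
  have "real n ^ Suc L * x = real n ^ L * x1 + of_int (int (n ^ L * i))"
    "real m ^ Suc L * y = real m ^ L * y1 + of_int (int (m ^ L * j))"
    using pos by (simp_all add: d field_simps)
  then show ?case using IH
    by (intro exI[of _ x'] exI[of _ y'] exI[of _ "z + int (n ^ L * i)"] exI[of _ "w + int (m ^ L * j)"]) simp
qed

text \<open>The number with \<open>U\<close> digits \<open>j\<close> in base \<open>m\<close>, that is \<open>\<Sum>q<U. j / m ^ Suc q\<close>.\<close>

definition block_height :: "nat \<Rightarrow> nat \<Rightarrow> real" where
  "block_height j U = real j / (real m - 1) * (1 - 1 / real m ^ U)"

lemma block_height_Suc: "block_height j (Suc U) = (real j + block_height j U) / real m"
  using m by (simp add: block_height_def field_simps)

lemma block_height_bounds: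
  assumes "j < m"
  shows "0 \<le> block_height j U" "block_height j U + 1 / real m ^ U \<le> 1"
proof -
  have p: "0 \<le> 1 - 1 / real m ^ U" using m by simp
  have j: "0 \<le> real j / (real m - 1)" "real j / (real m - 1) \<le> 1" using assms m by (auto simp: field_simps)
  show "0 \<le> block_height j U" unfolding block_height_def by (rule mult_nonneg_nonneg[OF j(1) p])
  have "block_height j U \<le> 1 * (1 - 1 / real m ^ U)"
    unfolding block_height_def by (rule mult_right_mono[OF j(2) p])
  then show "block_height j U + 1 / real m ^ U \<le> 1" by simp
qed

text \<open>A height strictly inside the interval of numbers starting with \<open>U\<close> digits \<open>j\<close> has no other
first \<open>U\<close> digits.  So the first \<open>U\<close> horizontal digits of the point belong to row \<open>j\<close>.\<close>

lemma near_slice_if_block: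
  assumes "j \<in> snd ` \<Lambda>"
  shows "(x, y) \<in> K \<Longrightarrow> block_height j U < y \<Longrightarrow> y < block_height j U + 1 / real m ^ U \<Longrightarrow>
    \<exists>s\<in>slice j. \<bar>x - s\<bar> \<le> 1 / real n ^ U"
proof (induction U arbitrary: x y)
  case 0
  interpret S: digit_set n "slice_digits j" "slice j" by (rule slice_digit_set[OF assms])
  obtain s where s: "s \<in> slice j" using S.nonempty by blast
  have "\<bar>x - s\<bar> \<le> 1" using S.unit_interval[OF s] unit_square(1)[OF 0(1)] by linarith
  then show ?case using s by auto
next
  case (Suc U)
  interpret S: digit_set n "slice_digits j" "slice j" by (rule slice_digit_set[OF assms])
  obtain i j' x' y' where d: "(i, j') \<in> \<Lambda>" "(x', y') \<in> K" "x = (x' + real i) / real n"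
    "y = (y' + real j') / real m" using Suc.prems(1) by (rule unstep)
  have jm: "j < m" using assms digits by auto
  have "block_height j (Suc U) + 1 / real m ^ Suc U = (real j + block_height j U + 1 / real m ^ U) / real m"
    by (simp add: block_height_Suc add_divide_distrib mult.commute)
  then have "real j + block_height j U < y' + real j'" "y' + real j' < real j + block_height j U + 1 / real m ^ U"
    using Suc.prems(2,3) pos unfolding d(4) block_height_Suc by (simp_all add: divide_less_cancel)
  moreover have "0 \<le> y'" "y' \<le> 1" using unit_square d(2) by blast+
  ultimately have "real j' < real j + 1" "real j < real j' + 1"
    using block_height_bounds[OF jm, of U] by linarith+
  then have "j' = j" by linarith
  then have "block_height j U < y'" "y' < block_height j U + 1 / real m ^ U"
    using \<open>real j + block_height j U < _\<close> \<open>_ < real j + block_height j U + _\<close> by simp_all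
  from Suc.IH[OF d(2) this] obtain s where s: "s \<in> slice j" "\<bar>x' - s\<bar> \<le> 1 / real n ^ U" by blast
  have "(s + real i) / real n \<in> slice j"
    using S.step[of i s] s(1) d(1) \<open>j' = j\<close> by (simp add: slice_digits_def)
  moreover have "\<bar>x - (s + real i) / real n\<bar> = \<bar>x' - s\<bar> / real n"
    unfolding d(3) using pos by (simp add: diff_divide_distrib[symmetric] abs_divide)
  moreover have "\<bar>x' - s\<bar> / real n \<le> 1 / real n ^ Suc U"
    using divide_right_mono[OF s(2), of "real n"] by (simp add: mult.commute)
  ultimately show ?case by metis
qed

lemma near_slice_if_deep_block:
  assumes j: "j \<in> snd ` \<Lambda>" and K: "(x, y) \<in> K"
    and y: "of_int z + block_height j U < real m ^ L * y"
      "real m ^ L * y < of_int z + block_height j U + 1 / real m ^ U"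
  shows "infdist (real n ^ L * x) (int_translates (slice j)) \<le> 1 / real n ^ U"
proof -
  obtain x' y' v w where s: "(x', y') \<in> K" "real n ^ L * x = x' + of_int v" "real m ^ L * y = y' + of_int w"
    using shift[OF K] by blast
  have "0 \<le> y'" "y' \<le> 1" using unit_square s(1) by blast+
  moreover have "j < m" using j digits by auto
  ultimately have "of_int w < of_int z + (1::real)" "of_int z < of_int w + (1::real)"
    using y s(3) block_height_bounds[of j U] by linarith+
  then have "w = z" by linarith
  then obtain t where t: "t \<in> slice j" "\<bar>x' - t\<bar> \<le> 1 / real n ^ U"
    using near_slice_if_block[OF j s(1), of U] y s(3) by auto
  have "infdist (real n ^ L * x) (int_translates (slice j)) \<le> dist (real n ^ L * x) (t + of_int v)"
    by (intro infdist_le int_translatesI t(1))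
  also have "\<dots> \<le> 1 / real n ^ U" using t(2) by (simp add: s(2) dist_real_def)
  finally show ?thesis .
qed

end

section \<open>Images of cylinders when every row occurs\<close>

lemma grid_point_in_window:
  fixes \<sigma> c \<tau> :: real
  assumes "0 < \<sigma>"
  shows "\<exists>(q::nat) (z::int). real q \<le> 1 / \<sigma> + 1 \<and> of_int z + \<tau> \<le> c + \<sigma> * q \<and> c + \<sigma> * q < of_int z + \<tau> + \<sigma>"
proof -
  define z where "z = \<lceil>c - \<tau>\<rceil>"
  define v where "v = of_int z + \<tau> - c"
  have v: "0 \<le> v" "v < 1" unfolding v_def z_def by linarith+
  define q where "q = nat \<lceil>v / \<sigma>\<rceil>"
  have "0 \<le> v / \<sigma>" using v assms by simp
  then have q: "v / \<sigma> \<le> q" "q < v / \<sigma> + 1" unfolding q_def by linarith+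
  have "v / \<sigma> \<le> 1 / \<sigma>" using v assms by (intro divide_right_mono) auto
  then have "real q \<le> 1 / \<sigma> + 1" using q by linarith
  moreover have "v \<le> \<sigma> * q" "\<sigma> * q < v + \<sigma>" using q assms by (simp_all add: field_simps)
  ultimately show ?thesis unfolding v_def
    by (intro exI[of _ q] exI[of _ z]) linarith
qed

context carpet
begin

text \<open>If every row occurs, the vertical digits of a cylinder can be chosen freely.\<close>

lemma cylinder_at_height:
  assumes full: "snd ` \<Lambda> = {0..<m}" and "q < m ^ l"
  shows "\<exists>\<xi>. 0 \<le> \<xi> \<and> \<xi> \<le> 1 \<and> (\<forall>x y. (x, y) \<in> K \<longrightarrow> (x / real n ^ l + \<xi>, (y + real q) / real m ^ l) \<in> K)"
  using assms(2)
proof (induction l arbitrary: q)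
  case 0
  then show ?case by (intro exI[of _ 0]) simp
next
  case (Suc l)
  define j where "j = q div m ^ l"
  define q' where "q' = q mod m ^ l"
  have q: "q = j * m ^ l + q'" unfolding j_def q'_def by (rule div_mult_mod_eq[symmetric])
  have "q' < m ^ l" using m by (simp add: q'_def)
  from Suc.IH[OF this] obtain \<xi> where \<xi>: "0 \<le> \<xi>" "\<xi> \<le> 1"
    and IH: "\<And>x y. (x, y) \<in> K \<Longrightarrow> (x / real n ^ l + \<xi>, (y + real q') / real m ^ l) \<in> K" by blast
  have "j < m" using Suc.prems m by (simp add: j_def less_mult_imp_div_less)
  then have "j \<in> snd ` \<Lambda>" using full by simp
  then obtain i where d: "(i, j) \<in> \<Lambda>" by force
  then have "real i \<le> real n - 1" using digits by force
  then have "0 \<le> (\<xi> + real i) / real n" "(\<xi> + real i) / real n \<le> 1" using \<xi> pos by (auto simp: field_simps)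
  moreover have "(x / real n ^ Suc l + (\<xi> + real i) / real n, (y + real q) / real m ^ Suc l) \<in> K"
    if "(x, y) \<in> K" for x y
  proof -
    have "(y + real q) / real m ^ Suc l = ((y + real q') / real m ^ l + real j) / real m"
      using pos by (simp add: q field_simps)
    then show ?thesis using step[OF d IH[OF that]]
      by (simp add: add_divide_distrib mult.commute add.assoc)
  qed
  ultimately show ?case by blast
qed

text \<open>The freedom that full rows give: some cylinder of level \<open>l\<close> is mapped by \<open>\<mu>\<close> into heights whose
digits at the levels after \<open>l + k\<close> are prescribed by the window \<open>(\<tau>, \<tau> + \<eta>)\<close>.  The vertical word
of the last \<open>l1\<close> levels is the integer \<open>q\<close>; raising \<open>q\<close> by one moves the magnified image by
\<open>\<sigma> = m ^ k * Re \<mu>\<close>, which is at most a quarter of the window, so some \<open>q\<close> hits it.  The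
horizontal word that comes with \<open>q\<close> is not under control, but \<open>l0\<close> preceding levels reduce its
influence \<open>e\<close> on the height by the factor \<open>(m / n) ^ l0\<close>.\<close>

lemma cylinder_image_in_window:
  assumes full: "snd ` \<Lambda> = {0..<m}" and \<mu>: "0 < Re \<mu>" and fine: "real m ^ k * Re \<mu> \<le> \<eta> / 4"
  shows "\<exists>l\<ge>L. \<exists>\<xi> \<zeta> (z::int). \<forall>x y. (x, y) \<in> K \<longrightarrow>
    (x / real n ^ l + \<xi>, y / real m ^ l + \<zeta>) \<in> K \<and>
    of_int z + \<tau> < real m ^ (l + k) * (Im \<mu> * (x / real n ^ l + \<xi>) + Re \<mu> * (y / real m ^ l + \<zeta>) + c) \<and>
    real m ^ (l + k) * (Im \<mu> * (x / real n ^ l + \<xi>) + Re \<mu> * (y / real m ^ l + \<zeta>) + c) < of_int z + \<tau> + \<eta>"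
proof -
  define \<sigma> where "\<sigma> = real m ^ k * Re \<mu>"
  have \<sigma>: "0 < \<sigma>" "\<sigma> \<le> \<eta> / 4" using \<mu> fine pos by (auto simp: \<sigma>_def)
  obtain l1 where l1: "1 / \<sigma> + 1 < real m ^ l1" using real_arch_pow[of "real m"] m by auto
  define C where "C = 2 * \<bar>Im \<mu>\<bar> * real m ^ (l1 + k)"
  have "\<forall>\<^sub>F l in sequentially. C * (real m / real n) ^ l < \<eta> / 4 \<and> L \<le> l"
    using ratio_power_small[of m n "\<eta> / 4" C] \<sigma> mn m by (intro eventually_conj eventually_ge_at_top) auto
  then obtain l0 where l0: "C * (real m / real n) ^ l0 < \<eta> / 4" "L \<le> l0"
    using eventually_happens'[OF sequentially_bot] by blast
  obtain \<xi>0 \<zeta>0 where c0: "\<And>x y. (x, y) \<in> K \<Longrightarrow> (x / real n ^ l0 + \<xi>0, y / real m ^ l0 + \<zeta>0) \<in> K"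
    using cylinder[of l0] by blast
  define B where "B = real m ^ (l0 + l1 + k) * (Im \<mu> * \<xi>0 + Re \<mu> * \<zeta>0 + c)"
  obtain q :: nat and z :: int where q: "real q \<le> 1 / \<sigma> + 1" "of_int z + (\<tau> + \<eta> / 4) \<le> B + \<sigma> * q"
    "B + \<sigma> * q < of_int z + (\<tau> + \<eta> / 4) + \<sigma>"
    using grid_point_in_window[OF \<sigma>(1), of "\<tau> + \<eta> / 4" B] by blast
  have "real q < real m ^ l1" using q(1) l1 by linarith
  then have "real q < real (m ^ l1)" by (simp only: of_nat_power)
  then have "q < m ^ l1" by (simp only: of_nat_less_iff)
  from cylinder_at_height[OF full this] obtain \<xi>1 where \<xi>1: "0 \<le> \<xi>1" "\<xi>1 \<le> 1"
    "\<And>x y. (x, y) \<in> K \<Longrightarrow> (x / real n ^ l1 + \<xi>1, (y + real q) / real m ^ l1) \<in> K" by blast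
  define \<xi> where "\<xi> = \<xi>1 / real n ^ l0 + \<xi>0"
  define \<zeta> where "\<zeta> = real q / real m ^ (l0 + l1) + \<zeta>0"
  show ?thesis
  proof (rule exI[of _ "l0 + l1"], rule conjI, goal_cases)
    case 1
    show ?case using l0(2) by simp
  next
    case 2
    show ?case
    proof (rule exI[of _ \<xi>], rule exI[of _ \<zeta>], rule exI[of _ z], intro allI impI conjI)
      fix x y assume K: "(x, y) \<in> K"
      let ?X = "x / real n ^ (l0 + l1) + \<xi>" and ?Y = "y / real m ^ (l0 + l1) + \<zeta>"
      have X: "?X = (x / real n ^ l1 + \<xi>1) / real n ^ l0 + \<xi>0"
        by (simp add: \<xi>_def power_add add_divide_distrib mult.commute)
      have Y: "?Y = (y + real q) / real m ^ l1 / real m ^ l0 + \<zeta>0"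
        by (simp add: \<zeta>_def power_add add_divide_distrib mult.commute)
      show "(?X, ?Y) \<in> K" unfolding X Y by (rule c0[OF \<xi>1(3)[OF K]])
      define e where "e = real m ^ (l0 + l1 + k) * (Im \<mu> * ((x / real n ^ l1 + \<xi>1) / real n ^ l0))"
      have scaled: "real m ^ (l0 + l1 + k) * (Re \<mu> * ((y + real q) / real m ^ l1 / real m ^ l0)) = \<sigma> * (y + q)"
        using pos by (simp add: \<sigma>_def power_add)
      have val: "real m ^ (l0 + l1 + k) * (Im \<mu> * ?X + Re \<mu> * ?Y + c) = B + \<sigma> * q + \<sigma> * y + e"
      proof -
        have "M * (Im \<mu> * (u + \<xi>0) + Re \<mu> * (v + \<zeta>0) + c)
            = M * (Im \<mu> * \<xi>0 + Re \<mu> * \<zeta>0 + c) + M * (Re \<mu> * v) + M * (Im \<mu> * u)" for M u v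
          by (simp add: algebra_simps)
        then show ?thesis unfolding X Y B_def e_def
          using scaled by (simp add: distrib_left[of \<sigma>])
      qed
      have xy: "0 \<le> x" "x \<le> 1" "0 \<le> y" "y \<le> 1" using unit_square K by blast+
      have "\<bar>x / real n ^ l1 + \<xi>1\<bar> \<le> 2"
      proof -
        have "1 \<le> real n ^ l1" using mn by (intro one_le_power) auto
        then have "0 \<le> x / real n ^ l1" "x / real n ^ l1 \<le> 1" using xy by (auto simp: divide_le_eq_1)
        then show ?thesis using \<xi>1 by linarith
      qed
      then have "\<bar>x / real n ^ l1 + \<xi>1\<bar> * (\<bar>Im \<mu>\<bar> * real m ^ (l1 + k) * (real m / real n) ^ l0)
          \<le> 2 * (\<bar>Im \<mu>\<bar> * real m ^ (l1 + k) * (real m / real n) ^ l0)"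
        by (intro mult_right_mono) auto
      moreover have "\<bar>e\<bar> = \<bar>x / real n ^ l1 + \<xi>1\<bar> * (\<bar>Im \<mu>\<bar> * real m ^ (l1 + k) * (real m / real n) ^ l0)"
        by (simp add: e_def abs_mult power_add power_divide mult_ac)
      ultimately have e: "\<bar>e\<bar> < \<eta> / 4" using l0(1) by (simp add: C_def mult_ac)
      have "0 \<le> \<sigma> * y" "\<sigma> * y \<le> \<sigma>" using \<sigma> xy mult_left_le[of y \<sigma>] by auto
      then show "of_int z + \<tau> < real m ^ (l0 + l1 + k) * (Im \<mu> * ?X + Re \<mu> * ?Y + c)"
        "real m ^ (l0 + l1 + k) * (Im \<mu> * ?X + Re \<mu> * ?Y + c) < of_int z + \<tau> + \<eta>"
        unfolding val using e q(2,3) \<sigma>(2) by linarith+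
    qed
  qed
qed

text \<open>Take the slice with digit \<open>j'\<close> inside a cylinder whose image has its heights in the window of
\<open>U\<close> digits \<open>j\<close>.  The slice is horizontal, so \<open>\<mu>\<close> scales its horizontal coordinate by \<open>Re \<mu>\<close>
alone, whatever the angle of the rotation.\<close>

lemma slice_maps_near_slice:
  assumes full: "snd ` \<Lambda> = {0..<m}" and inv: "plane_similarity \<mu> a ` K \<subseteq> K"
    and \<mu>: "0 < Re \<mu>" and fine: "real m ^ (k + U) * Re \<mu> \<le> 1 / 4" and j: "j < m"
  shows "\<exists>c. \<forall>x\<in>slice j'. infdist (real n ^ k * Re \<mu> * x + c) (int_translates (slice j)) \<le> 1 / real n ^ U"
proof -
  have j\<Lambda>: "j \<in> snd ` \<Lambda>" using full j by simp
  have "real m ^ k * Re \<mu> \<le> (1 / real m ^ U) / 4" using fine pos by (simp add: power_add field_simps)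
  from cylinder_image_in_window[OF full \<mu> this, of 0 "block_height j U" "snd a"]
  obtain l \<xi> \<zeta> and z :: int where *: "\<And>x y. (x, y) \<in> K \<Longrightarrow> (x / real n ^ l + \<xi>, y / real m ^ l + \<zeta>) \<in> K"
    "\<And>x y. (x, y) \<in> K \<Longrightarrow> of_int z + block_height j U <
      real m ^ (l + k) * (Im \<mu> * (x / real n ^ l + \<xi>) + Re \<mu> * (y / real m ^ l + \<zeta>) + snd a)"
    "\<And>x y. (x, y) \<in> K \<Longrightarrow> real m ^ (l + k) * (Im \<mu> * (x / real n ^ l + \<xi>) + Re \<mu> * (y / real m ^ l + \<zeta>) + snd a)
      < of_int z + block_height j U + 1 / real m ^ U" by blast
  define y where "y = real j' / (real m - 1)"
  define c where "c = real n ^ (l + k) * (Re \<mu> * \<xi> - Im \<mu> * (y / real m ^ l + \<zeta>) + fst a)"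
  show ?thesis
  proof (intro exI[of _ c] ballI)
    fix x assume "x \<in> slice j'"
    then have K: "(x, y) \<in> K" by (simp add: slice_def y_def)
    let ?X = "x / real n ^ l + \<xi>" and ?Y = "y / real m ^ l + \<zeta>"
    have img: "(Re \<mu> * ?X - Im \<mu> * ?Y + fst a, Im \<mu> * ?X + Re \<mu> * ?Y + snd a) \<in> K"
      using subsetD[OF inv imageI[OF *(1)[OF K]]] by (simp only: plane_similarity_def fst_conv snd_conv)
    have "real n ^ (l + k) * (Re \<mu> * ?X - Im \<mu> * ?Y + fst a) = real n ^ k * Re \<mu> * x + c"
    proof -
      have "M * (Re \<mu> * (u + \<xi>) - v + fst a) = M * (Re \<mu> * u) + M * (Re \<mu> * \<xi> - v + fst a)" for M u v
        by (simp add: algebra_simps)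
      moreover have "real n ^ (l + k) * (Re \<mu> * (x / real n ^ l)) = real n ^ k * Re \<mu> * x"
        using pos by (simp add: power_add)
      ultimately show ?thesis unfolding c_def by simp
    qed
    then show "infdist (real n ^ k * Re \<mu> * x + c) (int_translates (slice j)) \<le> 1 / real n ^ U"
      using near_slice_if_deep_block[OF j\<Lambda> img *(2)[OF K] *(3)[OF K]] by simp
  qed
qed

text \<open>Letting the number \<open>U\<close> of prescribed digits tend to infinity turns the near-inclusions of
slices into inclusions.  The factor \<open>u\<close> serves all pairs of rows at once, because the powers of
\<open>\<mu>\<close> are chosen before the rows.\<close>

lemma slice_contains_copy_of_slice:
  assumes full: "snd ` \<Lambda> = {0..<m}" and inv: "plane_similarity \<mu> a ` K \<subseteq> K"
    and \<mu>: "0 < norm \<mu>" "norm \<mu> < 1" and \<delta>: "0 < \<delta>" "\<delta> \<le> 1 / 2"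
    and incomm: "\<And>k t. 0 < t \<Longrightarrow> real n ^ k * norm \<mu> ^ t \<noteq> 1"
  shows "\<exists>u. 1 - \<delta> < u \<and> u < 1 \<and>
    (\<forall>j<m. \<forall>j'. \<exists>c. \<forall>x\<in>slice j'. u * x + c \<in> int_translates (slice j))"
proof -
  obtain u0 and k t :: "nat \<Rightarrow> nat" where u0: "1 - \<delta> < u0" "u0 < 1"
    and lim: "(\<lambda>U. real n ^ k U * Re (\<mu> ^ t U)) \<longlonglongrightarrow> u0"
    and Re: "\<And>U. 0 < Re (\<mu> ^ t U)" "\<And>U. real m ^ (k U + U) * Re (\<mu> ^ t U) \<le> 1 / 4"
    by (rule scales_of_prescribed_depth[OF m mn \<mu> \<delta>], erule incomm, (rule that; blast))
  have "\<exists>c. \<forall>x\<in>slice j'. u0 * x + c \<in> int_translates (slice j)" if j: "j < m" for j j'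
  proof (rule affine_copy_limit[OF _ _ lim])
    interpret S: digit_set n "slice_digits j" "slice j" using slice_digit_set j full by simp
    show "compact (slice j)" "slice j \<noteq> {}" by (rule S.compact S.nonempty)+
    show "(\<lambda>U. (1 / real n) ^ U) \<longlonglongrightarrow> 0" using m mn by (intro LIMSEQ_realpow_zero) auto
    fix U
    obtain c where "plane_similarity (\<mu> ^ t U) c ` K \<subseteq> K" using plane_similarity_iterate[OF inv] by blast
    from slice_maps_near_slice[OF full this Re j]
    show "\<exists>c. \<forall>x\<in>slice j'. infdist (real n ^ k U * Re (\<mu> ^ t U) * x + c) (int_translates (slice j)) \<le> (1 / real n) ^ U"
      by (simp add: power_one_over)
  qed
  then show ?thesis using u0 by blast
qed

section \<open>Carpets with full set of rows\<close>

text \<open>With one digit in each row, the horizontal word is a function of the vertical one.\<close>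

lemma row_determines_column:
  assumes unique: "\<And>i i' j. (i, j) \<in> \<Lambda> \<Longrightarrow> (i', j) \<in> \<Lambda> \<Longrightarrow> i = i'"
  shows "(x, y) \<in> K \<Longrightarrow> (x', y') \<in> K \<Longrightarrow>
    of_int z < real m ^ L * y \<Longrightarrow> real m ^ L * y < of_int z + 1 \<Longrightarrow>
    of_int z < real m ^ L * y' \<Longrightarrow> real m ^ L * y' < of_int z + 1 \<Longrightarrow> \<bar>x - x'\<bar> \<le> 1 / real n ^ L"
proof (induction L arbitrary: x y x' y' z)
  case 0
  then have "0 \<le> x" "x \<le> 1" "0 \<le> x'" "x' \<le> 1" using unit_square by blast+
  then show ?case by simp
next
  case (Suc L)
  obtain i j x1 y1 where d: "(i, j) \<in> \<Lambda>" "(x1, y1) \<in> K" "x = (x1 + real i) / real n" "y = (y1 + real j) / real m"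
    using Suc.prems(1) by (rule unstep)
  obtain i' j' x1' y1' where d': "(i', j') \<in> \<Lambda>" "(x1', y1') \<in> K" "x' = (x1' + real i') / real n"
    "y' = (y1' + real j') / real m" using Suc.prems(2) by (rule unstep)
  have row: "z div int (m ^ L) = int e" if "(u, v) \<in> K" "of_int z < real m ^ L * (v + real e)"
    "real m ^ L * (v + real e) < of_int z + 1" for u v e
  proof -
    have v: "0 \<le> v" "v \<le> 1" using unit_square that(1) by blast+
    have "real m ^ L * real e \<le> real m ^ L * (v + real e)"
      using v by (intro mult_left_mono) auto
    then have "of_int (int (m ^ L) * int e) < real_of_int (z + 1)" using that(3) by simp
    moreover have "real m ^ L * (v + real e) \<le> real m ^ L * (1 + real e)"
      using v by (intro mult_left_mono) auto
    then have "real_of_int z < of_int (int (m ^ L) * (1 + int e))" using that(2) by simp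
    ultimately have "int (m ^ L) * int e \<le> z" "z < int (m ^ L) * (1 + int e)"
      unfolding of_int_less_iff by auto
    then show ?thesis using m by (intro int_div_pos_eq[of _ _ _ "z - int (m ^ L) * int e"]) (auto simp: algebra_simps)
  qed
  have eq: "real m ^ Suc L * y = real m ^ L * (y1 + real j)" "real m ^ Suc L * y' = real m ^ L * (y1' + real j')"
    using pos by (simp_all add: d(4) d'(4))
  have "int j = int j'"
    using row[OF d(2), of j] row[OF d'(2), of j'] Suc.prems(3-6) unfolding eq by simp
  then have jj: "j' = j" by simp
  then have ii: "i' = i" using unique d(1) d'(1) by blast
  note bounds = Suc.prems(3-6)[unfolded eq jj]
  have "\<bar>x1 - x1'\<bar> \<le> 1 / real n ^ L"
    by (rule Suc.IH[OF d(2) d'(2), of "z - int (m ^ L * j)"])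
       (use bounds in \<open>simp_all add: distrib_left\<close>)
  then have "\<bar>x1 - x1'\<bar> / real n \<le> 1 / real n ^ L / real n" using pos by (intro divide_right_mono) auto
  moreover have "x - x' = (x1 - x1') / real n"
    by (simp add: d(3) d'(3) ii diff_divide_distrib add_divide_distrib)
  ultimately show ?case by (simp add: abs_divide mult.commute)
qed

text \<open>Two points of a cylinder whose image lies in a single row of level \<open>l + k\<close> have images with
horizontal distance at most \<open>n ^ - (l + k)\<close>; the claim is this bound magnified by \<open>n ^ l\<close>.\<close>

lemma graph_carpet_distortion:
  assumes full: "snd ` \<Lambda> = {0..<m}" and unique: "\<And>i i' j. (i, j) \<in> \<Lambda> \<Longrightarrow> (i', j) \<in> \<Lambda> \<Longrightarrow> i = i'"
    and inv: "plane_similarity \<mu> a ` K \<subseteq> K" and \<mu>: "0 < Re \<mu>" and fine: "real m ^ k * Re \<mu> \<le> 1 / 4"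
    and p: "(x, y) \<in> K" and q: "(x', y') \<in> K"
  shows "\<exists>l\<ge>L. \<bar>Re \<mu> * (x - x') - Im \<mu> * (y - y') * (real n / real m) ^ l\<bar> \<le> 1 / real n ^ k"
proof -
  from cylinder_image_in_window[OF full \<mu> fine, of L 0 "snd a"]
  obtain l \<xi> \<zeta> and z :: int where l: "L \<le> l" and
    *: "\<And>x y. (x, y) \<in> K \<Longrightarrow> (x / real n ^ l + \<xi>, y / real m ^ l + \<zeta>) \<in> K"
    "\<And>x y. (x, y) \<in> K \<Longrightarrow> of_int z + 0 <
      real m ^ (l + k) * (Im \<mu> * (x / real n ^ l + \<xi>) + Re \<mu> * (y / real m ^ l + \<zeta>) + snd a)"
    "\<And>x y. (x, y) \<in> K \<Longrightarrow> real m ^ (l + k) * (Im \<mu> * (x / real n ^ l + \<xi>) + Re \<mu> * (y / real m ^ l + \<zeta>) + snd a)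
      < of_int z + 0 + 1" by blast
  have img: "(Re \<mu> * (x / real n ^ l + \<xi>) - Im \<mu> * (y / real m ^ l + \<zeta>) + fst a,
      Im \<mu> * (x / real n ^ l + \<xi>) + Re \<mu> * (y / real m ^ l + \<zeta>) + snd a) \<in> K" if "(x, y) \<in> K" for x y
    using subsetD[OF inv imageI[OF *(1)[OF that]]] by (simp only: plane_similarity_def fst_conv snd_conv)
  have "\<bar>(Re \<mu> * (x / real n ^ l + \<xi>) - Im \<mu> * (y / real m ^ l + \<zeta>) + fst a)
      - (Re \<mu> * (x' / real n ^ l + \<xi>) - Im \<mu> * (y' / real m ^ l + \<zeta>) + fst a)\<bar> \<le> 1 / real n ^ (l + k)"
    by (rule row_determines_column[OF _ img[OF p] img[OF q], where z = z])
       (erule (1) unique | use *(2)[OF p] *(2)[OF q] *(3)[OF p] *(3)[OF q] in simp)+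
  also have "(Re \<mu> * (x / real n ^ l + \<xi>) - Im \<mu> * (y / real m ^ l + \<zeta>) + fst a)
      - (Re \<mu> * (x' / real n ^ l + \<xi>) - Im \<mu> * (y' / real m ^ l + \<zeta>) + fst a)
    = Re \<mu> * (x - x') / real n ^ l - Im \<mu> * (y - y') * (1 / real m ^ l)"
    by (simp add: right_diff_distrib distrib_left diff_divide_distrib)
  also have "1 / real m ^ l = (real n / real m) ^ l / real n ^ l"
    using pos by (simp add: power_divide)
  also have "Re \<mu> * (x - x') / real n ^ l - Im \<mu> * (y - y') * ((real n / real m) ^ l / real n ^ l)
    = (Re \<mu> * (x - x') - Im \<mu> * (y - y') * (real n / real m) ^ l) / real n ^ l"
    by (simp only: diff_divide_distrib times_divide_eq_right)
  finally have "\<bar>Re \<mu> * (x - x') - Im \<mu> * (y - y') * (real n / real m) ^ l\<bar> / real n ^ l \<le> 1 / real n ^ (l + k)"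
    by (simp only: abs_divide power_abs abs_of_nat)
  moreover have "1 / real n ^ (l + k) = 1 / real n ^ k / real n ^ l" by (simp add: power_add)
  ultimately have "\<bar>Re \<mu> * (x - x') - Im \<mu> * (y - y') * (real n / real m) ^ l\<bar> \<le> 1 / real n ^ k"
    using pos by (simp only: divide_le_cancel zero_less_power)
  then show ?thesis using l by blast
qed

text \<open>The distortion bound holds for arbitrarily large \<open>l\<close>, where \<open>(n / m) ^ l\<close> is unbounded.  Points
at different heights thus show that \<open>\<mu> ^ t\<close> is real, and then the bound reads
\<open>Re (\<mu> ^ t) * |x - x'| \<le> n ^ - (k + U)\<close>, where \<open>Re (\<mu> ^ t)\<close> is at least half of \<open>n ^ - k\<close>.  So \<open>K\<close>
lies in a vertical line.\<close>

lemma graph_carpet_no_self_similarity: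
  assumes full: "snd ` \<Lambda> = {0..<m}" and unique: "\<And>i i' j. (i, j) \<in> \<Lambda> \<Longrightarrow> (i', j) \<in> \<Lambda> \<Longrightarrow> i = i'"
    and inv: "plane_similarity \<mu> a ` K \<subseteq> K" and \<mu>: "0 < norm \<mu>" "norm \<mu> < 1"
    and incomm: "\<And>k t. 0 < t \<Longrightarrow> real n ^ k * norm \<mu> ^ t \<noteq> 1"
    and xx: "x \<in> fst ` K" "x' \<in> fst ` K"
  shows "x = x'"
proof -
  have half: "0 < (1 / 2 :: real)" "1 / 2 \<le> (1 / 2 :: real)" by simp_all
  obtain k t :: "nat \<Rightarrow> nat" where
    Re: "\<And>U. 0 < Re (\<mu> ^ t U)" "\<And>U. 1 / 2 \<le> real n ^ k U * Re (\<mu> ^ t U)"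
      "\<And>U. real m ^ (k U + U) * Re (\<mu> ^ t U) \<le> 1 / 4"
    by (rule scales_of_prescribed_depth[OF m mn \<mu> half], erule incomm, (rule that; blast))
  have dist: "\<exists>l\<ge>L. \<bar>Re (\<mu> ^ t U) * (x - x') - Im (\<mu> ^ t U) * (y - y') * (real n / real m) ^ l\<bar> \<le> 1 / real n ^ (k U + U)"
    if "(x, y) \<in> K" "(x', y') \<in> K" for x y x' y' L U
  proof -
    obtain c where "plane_similarity (\<mu> ^ t U) c ` K \<subseteq> K" using plane_similarity_iterate[OF inv] by blast
    from graph_carpet_distortion[OF full unique this Re(1,3) that] show ?thesis .
  qed
  have "0 \<in> snd ` \<Lambda>" "1 \<in> snd ` \<Lambda>" using full m by auto
  then obtain i0 i1 where i: "(i0, 0) \<in> \<Lambda>" "(i1, 1) \<in> \<Lambda>" by force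
  define y1 where "y1 = 1 / (real m - 1)"
  have y1: "0 < y1" using m by (simp add: y1_def)
  obtain x0 x1 where p: "(x0, 0) \<in> K" "(x1, y1) \<in> K"
    using fixed_point_mem[OF i(1)] fixed_point_mem[OF i(2)] by (auto simp: y1_def)
  have Im: "Im (\<mu> ^ t U) = 0" for U
  proof (rule ccontr)
    assume nz: "Im (\<mu> ^ t U) \<noteq> 0"
    define g where "g = \<bar>Im (\<mu> ^ t U)\<bar> * y1"
    have g: "0 < g" using nz y1 by (simp add: g_def)
    define R where "R = \<bar>Re (\<mu> ^ t U) * (x1 - x0)\<bar> + 1"
    have r: "1 < real n / real m" using mn pos by simp
    obtain L where L: "R / g < (real n / real m) ^ L" using real_arch_pow[OF r] by blast
    obtain l where l: "L \<le> l" "\<bar>Re (\<mu> ^ t U) * (x1 - x0) - Im (\<mu> ^ t U) * (y1 - 0) * (real n / real m) ^ l\<bar> \<le> 1 / real n ^ (k U + U)"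
      using dist[OF p(2,1)] by blast
    have "(real n / real m) ^ L \<le> (real n / real m) ^ l" using l(1) r by (intro power_increasing) auto
    then have "g * (real n / real m) ^ L \<le> g * (real n / real m) ^ l" using g by simp
    moreover have "R < g * (real n / real m) ^ L"
      using L pos_divide_less_eq[OF g] by (simp add: mult.commute)
    ultimately have "R < g * (real n / real m) ^ l" by linarith
    also have "g * (real n / real m) ^ l = \<bar>Im (\<mu> ^ t U) * (y1 - 0) * (real n / real m) ^ l\<bar>"
      using y1 by (simp add: g_def abs_mult)
    finally have "R < \<bar>Im (\<mu> ^ t U) * (y1 - 0) * (real n / real m) ^ l\<bar>" .
    moreover have "1 / real n ^ (k U + U) \<le> 1" using mn by simp
    ultimately show False using l(2) unfolding R_def by linarith
  qed
  obtain y y' where q: "(x, y) \<in> K" "(x', y') \<in> K" using xx by force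
  have "\<bar>x - x'\<bar> \<le> 2 * (1 / real n) ^ U" for U
  proof -
    have "Re (\<mu> ^ t U) * \<bar>x - x'\<bar> \<le> 1 / real n ^ (k U + U)"
      using dist[OF q, of 0 U] Re(1)[of U] by (simp add: Im abs_mult)
    then have "real n ^ k U * (Re (\<mu> ^ t U) * \<bar>x - x'\<bar>) \<le> real n ^ k U * (1 / real n ^ (k U + U))"
      using pos by (intro mult_left_mono) auto
    also have "\<dots> = (1 / real n) ^ U" using pos by (simp add: power_add power_one_over)
    finally have "real n ^ k U * Re (\<mu> ^ t U) * \<bar>x - x'\<bar> \<le> (1 / real n) ^ U" by (simp only: mult.assoc)
    moreover have "1 / 2 * \<bar>x - x'\<bar> \<le> real n ^ k U * Re (\<mu> ^ t U) * \<bar>x - x'\<bar>"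
      using Re(2) by (intro mult_right_mono) auto
    ultimately have "1 / 2 * \<bar>x - x'\<bar> \<le> (1 / real n) ^ U" by (rule order_trans[rotated])
    then show ?thesis by simp
  qed
  moreover have "(\<lambda>U. 2 * (1 / real n) ^ U) \<longlonglongrightarrow> 2 * 0"
    using m mn by (intro tendsto_mult tendsto_const LIMSEQ_realpow_zero) auto
  ultimately have "\<bar>x - x'\<bar> \<le> 2 * 0" using LIMSEQ_le_const by blast
  then show ?thesis by simp
qed

text \<open>If some row has at least two but not all digits, its slice would contain a copy of itself at a
scale just below 1.  Otherwise each row is full or has a single digit, and not all are full.
The slice of a full row contains 0 and 1, and two points at distance \<open>u\<close> strictly between 0 and
1 do not fit into the integer translates of a single point; so no row is full, and \<open>K\<close> is a graph
over the vertical axis.\<close>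

lemma full_rows_no_self_similarity:
  assumes full: "snd ` \<Lambda> = {0..<m}" and proper: "card \<Lambda> < m * n"
    and inv: "plane_similarity \<mu> a ` K \<subseteq> K" and \<mu>: "0 < norm \<mu>" "norm \<mu> < 1"
    and incomm: "\<And>k t. 0 < t \<Longrightarrow> real n ^ k * norm \<mu> ^ t \<noteq> 1"
    and wide: "x \<in> fst ` K" "x' \<in> fst ` K" "x \<noteq> x'"
  shows False
proof -
  have half: "0 < (1 / 2 :: real)" "1 / 2 \<le> (1 / 2 :: real)" by simp_all
  have copy: "\<exists>u. 1 - \<delta> < u \<and> u < 1 \<and>
      (\<forall>j<m. \<forall>j'. \<exists>c. \<forall>x\<in>slice j'. u * x + c \<in> int_translates (slice j))"
    if "0 < \<delta>" "\<delta> \<le> 1 / 2" for \<delta>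
    by (rule slice_contains_copy_of_slice[OF full inv \<mu> that]) (erule incomm)
  have ds: "digit_set n (slice_digits j) (slice j)" if "j < m" for j
    using slice_digit_set that full by simp
  have sub: "slice_digits j \<subseteq> {0..<n}" for j using digits by (auto simp: slice_digits_def)
  have card: "1 \<le> card (slice_digits j)" "card (slice_digits j) \<le> n" if "j < m" for j
  proof -
    interpret S: digit_set n "slice_digits j" "slice j" by (rule ds[OF that])
    have "card (slice_digits j) \<noteq> 0" using S.finite_digits S.digits_nonempty by simp
    then show "1 \<le> card (slice_digits j)" by linarith
    show "card (slice_digits j) \<le> n" using card_mono[OF _ sub] by fastforce
  qed
  show False
  proof (cases "\<exists>j<m. 2 \<le> card (slice_digits j) \<and> card (slice_digits j) < n")
    case True
    then obtain j where j: "j < m" "2 \<le> card (slice_digits j)" "card (slice_digits j) < n" by blast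
    interpret S: digit_set n "slice_digits j" "slice j" by (rule ds[OF j(1)])
    obtain \<epsilon> where \<epsilon>: "0 < \<epsilon>" "\<forall>u. 1 - \<epsilon> < u \<and> u < 1 \<longrightarrow> \<not> (\<exists>c. \<forall>x\<in>slice j. u * x + c \<in> int_translates (slice j))"
      using S.no_near_identity_copy[OF j(2,3)] by (elim exE conjE)
    have d: "0 < min \<epsilon> (1 / 2)" "min \<epsilon> (1 / 2) \<le> 1 / 2" using \<epsilon>(1) by auto
    obtain u where "1 - min \<epsilon> (1 / 2) < u" "u < 1" "\<exists>c. \<forall>x\<in>slice j. u * x + c \<in> int_translates (slice j)"
      using copy[OF d] j(1) by blast
    then show False using \<epsilon>(2)[rule_format, of u] by auto
  next
    case False
    then have dichotomy: "card (slice_digits j) = 1 \<or> card (slice_digits j) = n" if "j < m" for j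
      using card[OF that] that by force
    have full_row: "slice_digits j = {0..<n}" if "j < m" "card (slice_digits j) = n" for j
      using card_subset_eq[OF _ sub] that by simp
    have "\<exists>j<m. card (slice_digits j) = 1"
    proof (rule ccontr)
      assume "\<not> ?thesis"
      then have "{0..<n} \<times> {0..<m} \<subseteq> \<Lambda>" using dichotomy full_row by (fastforce simp: slice_digits_def)
      then have "\<Lambda> = {0..<n} \<times> {0..<m}" using digits by blast
      then show False using proper by (simp add: mult.commute)
    qed
    then obtain j0 where j0: "j0 < m" "card (slice_digits j0) = 1" by blast
    show False
    proof (cases "\<exists>j<m. card (slice_digits j) = n")
      case True
      then obtain j where j: "j < m" "slice_digits j = {0..<n}" using full_row by blast
      then have "(0, j) \<in> \<Lambda>" "(n - 1, j) \<in> \<Lambda>" using m mn by (auto simp: slice_digits_def set_eq_iff)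
      from fixed_point_mem[OF this(1)] fixed_point_mem[OF this(2)]
      have ends: "0 \<in> slice j" "1 \<in> slice j" using m mn by (simp_all add: slice_def of_nat_diff)
      obtain u where u: "1 - 1 / 2 < u" "u < 1"
        and "\<exists>c. \<forall>x\<in>slice j. u * x + c \<in> int_translates (slice j0)"
        using copy[OF half] j0(1) by blast
      then obtain c where c: "\<And>x. x \<in> slice j \<Longrightarrow> u * x + c \<in> int_translates (slice j0)" by blast
      interpret S: digit_set n "slice_digits j0" "slice j0" by (rule ds[OF j0(1)])
      have "c \<in> int_translates (slice j0)" "u + c \<in> int_translates (slice j0)" using c[OF ends(1)] c[OF ends(2)] by simp_all
      then obtain s z s' z' where "c = s + of_int z" "s \<in> slice j0" "u + c = s' + of_int z'" "s' \<in> slice j0"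
        unfolding int_translates_def by blast
      moreover from this have "s = s'" using S.singleton_if_card_1[OF j0(2)] by metis
      ultimately have "u = of_int (z' - z)" by simp
      then have "0 < z' - z" "z' - z < 1" using u by linarith+
      then show False by simp
    next
      case False
      have unique: "i = i'" if "(i, j) \<in> \<Lambda>" "(i', j) \<in> \<Lambda>" for i i' j
      proof -
        have "j < m" using digits that by auto
        then have "card (slice_digits j) = 1" using False dichotomy by blast
        then obtain e where "slice_digits j = {e}" by (rule card_1_singletonE)
        then have "\<And>i. (i, j) \<in> \<Lambda> \<Longrightarrow> i = e" unfolding slice_digits_def by blast
        then show ?thesis using that by blast
      qed
      have "x = x'"
        by (rule graph_carpet_no_self_similarity[OF full _ inv \<mu> _ wide(1,2)])
          (erule (1) unique, erule incomm)
      then show False using wide(3) by simp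
    qed
  qed
qed

end

section \<open>Contraction ratios\<close>

lemma not_in_hyperplane:
  fixes v :: "real \<times> real"
  assumes "\<not> (\<exists>L. affine L \<and> aff_dim L = 1 \<and> K \<subseteq> L)" "v \<noteq> 0"
  shows "\<exists>p\<in>K. v \<bullet> p \<noteq> (c::real)"
proof (rule ccontr)
  assume "\<not> ?thesis"
  then have "K \<subseteq> {p. v \<bullet> p = c}" by auto
  moreover have "aff_dim {p. v \<bullet> p = c} = 1" using aff_dim_hyperplane[OF assms(2), of c] by simp
  ultimately show False using assms(1) affine_hyperplane[of v c] by blast
qed

text \<open>The contrapositive is the form in which the irrationality of \<open>ln r / ln b\<close> enters: no power of
the ratio \<open>r\<^sup>2\<close> of \<open>f \<circ> f\<close> is a power of \<open>1 / b\<close>.\<close>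

lemma ln_ratio_rational_if_power_eq_1:
  assumes "1 < (b::real)" "0 < r" "b ^ k * (r\<^sup>2) ^ t = 1" "0 < t"
  shows "ln r / ln b \<in> \<rat>"
proof -
  have "ln (b ^ k * r ^ (2 * t)) = 0" using assms(3) by (simp add: power_mult)
  then have "real k * ln b + real (2 * t) * ln r = 0"
    using assms by (simp add: ln_mult ln_realpow)
  then have "ln r / ln b = - (real k / real (2 * t))"
    using assms by (simp add: field_simps)
  then show ?thesis by simp
qed

theorem theorem1p5:
  fixes n m :: nat and \<Lambda> :: "(nat \<times> nat) set"
    and f :: "real \<times> real \<Rightarrow> real \<times> real" and r :: real
  assumes "bm_digits n m \<Lambda>"
    and "ln (real n) / ln (real m) \<in> \<rat>"
    and "0 < r" and "is_similitude r f"
    and "f ` bm_carpet n m \<Lambda> \<subseteq> bm_carpet n m \<Lambda>"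
    and "\<not> (\<exists>L. affine L \<and> aff_dim L = 1 \<and> bm_carpet n m \<Lambda> \<subseteq> L)"
  shows "ln r / ln (real n) \<in> \<rat>"
proof (rule ccontr)
  assume irrational: "ln r / ln (real n) \<notin> \<rat>"
  let ?K = "bm_carpet n m \<Lambda>"
  interpret carpet n m \<Lambda> ?K
    using assms(1) is_attractor_bm_carpet by unfold_locales (auto simp: bm_digits_def)
  obtain \<mu> a where \<mu>: "norm \<mu> = r\<^sup>2" and ff: "\<And>p. f (f p) = plane_similarity \<mu> a p"
    using similitude_square[OF assms(4)] by blast
  have inv: "plane_similarity \<mu> a ` ?K \<subseteq> ?K" using assms(5) by (auto simp flip: ff)
  obtain p where p: "p \<in> ?K" using nonempty by blast
  obtain q where q: "q \<in> ?K" "fst q \<noteq> fst p"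
    using not_in_hyperplane[OF assms(6), of "(1, 0)" "fst p"] by (force simp: zero_prod_def)
  obtain q' where q': "q' \<in> ?K" "snd q' \<noteq> snd p"
    using not_in_hyperplane[OF assms(6), of "(0, 1)" "snd p"] by (force simp: zero_prod_def)
  have "r\<^sup>2 \<le> 1"
    using self_similarity_not_expanding[OF inv compact_imp_bounded[OF compact] p q(1)] q(2) \<mu> by auto
  moreover have "r\<^sup>2 \<noteq> 1"
  proof
    assume "r\<^sup>2 = 1"
    then have "r = 1" using assms(3) by (simp add: power2_eq_1_iff)
    then show False using irrational by simp
  qed
  ultimately have norm: "0 < norm \<mu>" "norm \<mu> < 1" using \<mu> assms(3) by simp_all
  have n1: "1 < real n" and m1: "1 < real m" using m mn by auto
  show False
  proof (cases "snd ` \<Lambda> = {0..<m}")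
    case True
    have incomm: "real n ^ k * norm \<mu> ^ t \<noteq> 1" if "0 < t" for k t
      using ln_ratio_rational_if_power_eq_1[OF n1 assms(3) _ that] irrational unfolding \<mu> by blast
    have "card \<Lambda> < m * n" using assms(1) by (simp add: bm_digits_def)
    then show False
      by (rule full_rows_no_self_similarity[OF True _ inv norm _ imageI[OF q(1)] imageI[OF p] q(2)])
        (erule incomm)
  next
    case False
    have incomm: "real m ^ k * norm \<mu> ^ t \<noteq> 1" if "0 < t" for k t
    proof
      assume "real m ^ k * norm \<mu> ^ t = 1"
      then have "ln r / ln (real m) \<in> \<rat>"
        using ln_ratio_rational_if_power_eq_1[OF m1 assms(3) _ that] unfolding \<mu> by blast
      \<comment> \<open>Rationality of \<open>ln n / ln m\<close> passes from base \<open>m\<close> to base \<open>n\<close>.\<close>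
      then have "(ln r / ln (real m)) / (ln (real n) / ln (real m)) \<in> \<rat>"
        using assms(2) by (rule Rats_divide)
      then show False using irrational m1 by simp
    qed
    show False
      by (rule missing_row_no_self_similarity[OF False inv norm _ imageI[OF q'(1)] imageI[OF p] q'(2)])
        (erule incomm)
  qed
qed

end
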